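(* Let $Q:\mathbb{T}^n\to[0,+\infty)$ be real analytic with nonempty zero set $\mathscr{Z}=\{\Phi\in\mathbb{T}^n: Q(\Phi)=0\}$. Let $L:=\max_{\mathbb{T}^n}\|\nabla Q\|$, and let $d>0$ and $N>0$ be constants for which the Łojasiewicz inequality $$|Q(\Phi)|\ge d\,\operatorname{dist}(\Phi,\mathscr{Z})^N\qquad\text{for all }\Phi\in\mathbb{T}^n$$ holds. Let $\Phi_0\in\mathbb{T}^n$ and let $\Phi\in\mathscr{A}$ be a global minimizer over $\mathscr{A}$ of $$K(\Phi)=\int_0^\infty\tfrac12\|\dot\Phi\|^2+Q(\Phi)\,dt .$$ Then, for any $t>0$, $$\operatorname{dist}(\Phi(t),\mathscr{Z})\le\sqrt[\tilde N]{\sigma_1\operatorname{dist}(\Phi_0,\mathscr{Z})}$$ and $$\operatorname{dist}(\Phi(t),\mathscr{Z})\le\sqrt[N\tilde N]{\sigma_2\,\frac{\operatorname{dist}(\Phi_0,\mathscr{Z})}{t}},$$ where $\tilde N:=\max\{2,N\}$, $$\sigma_1:=\frac{2\pi\sqrt n+L}{2}\max\left\{2^{\tilde N+1}(2\pi\sqrt n)^{\tilde N-2},\ \frac{2^{\tilde N}(2\pi\sqrt n)^{\tilde N-N}}{d}\right\}\quad\text{and}\quad \sigma_2:=\frac{(2\pi\sqrt n+L)\,\sigma_1^N}{2d}.$$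
   Context: $\mathbb{T}=\mathbb{R}/2\pi\mathbb{Z}$; distances on $\mathbb{T}^n$ are (quotient) Euclidean distances on the flat torus. $H^1_{loc}([0,+\infty);\mathbb{T}^n)$ is the set of maps $\Phi:[0,+\infty)\to\mathbb{T}^n$ belonging to $H^1((0,T);\mathbb{T}^n)$ for every $T>0$ (continuous, weakly differentiable with $\dot\Phi\in L^2((0,T);\mathbb{R}^n)$). The set of admissible trajectories is $$\mathscr{A}=\left\{\Phi\in H^1_{loc}([0,+\infty);\mathbb{T}^n)\ :\ \Phi(0)=\Phi_0,\ \tfrac12\|\dot\Phi\|^2+Q(\Phi)\in L^1(0,+\infty)\right\}.$$ *)

theory Defs
  imports "HOL-Analysis.Analysis"
begin

section \<open>The flat torus\<close>

definition torus_rel :: "real ^ 'n \<Rightarrow> real ^ 'n \<Rightarrow> bool" where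
  "torus_rel v w \<longleftrightarrow> (\<forall>i. \<exists>k::int. v $ i - w $ i = 2 * pi * of_int k)"

lemma torus_rel_refl: "torus_rel v v"
  unfolding torus_rel_def by (auto intro: exI[of _ "0::int"])

lemma torus_rel_sym: "torus_rel v w \<Longrightarrow> torus_rel w v"
  unfolding torus_rel_def
proof (intro allI)
  fix i assume "\<forall>i. \<exists>k::int. v $ i - w $ i = 2 * pi * of_int k"
  then obtain k :: int where "v $ i - w $ i = 2 * pi * of_int k" by blast
  then have "w $ i - v $ i = 2 * pi * of_int (- k)" by simp
  then show "\<exists>k::int. w $ i - v $ i = 2 * pi * of_int k" by blast
qed

lemma torus_rel_trans: "torus_rel u v \<Longrightarrow> torus_rel v w \<Longrightarrow> torus_rel u w"
  unfolding torus_rel_def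
proof (intro allI)
  fix i
  assume "\<forall>i. \<exists>k::int. u $ i - v $ i = 2 * pi * of_int k"
    and "\<forall>i. \<exists>k::int. v $ i - w $ i = 2 * pi * of_int k"
  then obtain k l :: int
    where "u $ i - v $ i = 2 * pi * of_int k" "v $ i - w $ i = 2 * pi * of_int l" by blast
  then have "u $ i - w $ i = 2 * pi * of_int (k + l)" by (simp add: algebra_simps)
  then show "\<exists>k::int. u $ i - w $ i = 2 * pi * of_int k" by blast
qed

quotient_type 'n torus = "real ^ ('n::finite)" / torus_rel
  morphisms rep_torus to_torus
  by (intro equivpI reflpI sympI transpI)
    (auto intro: torus_rel_refl torus_rel_sym torus_rel_trans)

lemma to_torus_eq_iff: "to_torus v = to_torus w \<longleftrightarrow> torus_rel v w"
  by (rule torus.abs_eq_iff)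

lemma to_torus_cases: obtains v where "x = to_torus v"
  by (metis Quotient_torus Quotient_abs_rep)

instantiation torus :: (finite) metric_space
begin

definition dist_torus :: "'a torus \<Rightarrow> 'a torus \<Rightarrow> real" where
  "dist_torus x y = Inf {norm (v - w) | v w. to_torus v = x \<and> to_torus w = y}"

definition uniformity_torus :: "('a torus \<times> 'a torus) filter" where
  "uniformity_torus = (INF e\<in>{0<..}. principal {(x, y). dist x y < e})"

definition open_torus :: "'a torus set \<Rightarrow> bool" where
  "open_torus U \<longleftrightarrow> (\<forall>x\<in>U. \<forall>\<^sub>F (x', y) in uniformity. x' = x \<longrightarrow> y \<in> U)"

lemma dist_torus_ne: "{norm (v - w) | v w. to_torus v = x \<and> to_torus w = y} \<noteq> {}"
  for x y :: "'a torus"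
  by (metis (mono_tags, lifting) empty_Collect_eq to_torus_cases)

lemma dist_torus_le: "dist (to_torus v) (to_torus w) \<le> norm (v - w)" for v w :: "real ^ 'a"
  unfolding dist_torus_def by (rule cInf_lower) (auto intro!: bdd_belowI[of _ 0])

lemma dist_torus_approx:
  fixes x y :: "'a torus"
  assumes "e > 0"
  obtains v w where "to_torus v = x" "to_torus w = y" "norm (v - w) < dist x y + e"
proof -
  have "Inf {norm (v - w) | v w. to_torus v = x \<and> to_torus w = y} < dist x y + e"
    using assms by (simp add: dist_torus_def)
  from cInf_lessD[OF dist_torus_ne this] show ?thesis using that by auto
qed

instance
proof
  fix x y z :: "'a torus"
  have nonneg: "0 \<le> dist x y" for x y :: "'a torus"
    unfolding dist_torus_def by (rule cInf_greatest[OF dist_torus_ne]) auto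
  show "dist x y = 0 \<longleftrightarrow> x = y"
  proof
    assume "x = y"
    obtain v where "x = to_torus v" by (rule to_torus_cases)
    with \<open>x = y\<close> dist_torus_le[of v v] nonneg[of x y] show "dist x y = 0" by simp
  next
    assume d: "dist x y = 0"
    obtain v w where vw: "x = to_torus v" "y = to_torus w" by (metis to_torus_cases)
    have "torus_rel v w"
      unfolding torus_rel_def
    proof
      fix i
      have "(v $ i - w $ i) / (2 * pi) \<in> closure (\<int> :: real set)"
        unfolding closure_approachable
      proof (intro allI impI)
        fix e :: real assume "e > 0"
        then have "2 * pi * e > 0" by simp
        then obtain a b where ab: "to_torus a = x" "to_torus b = y" "norm (a - b) < 2 * pi * e"
          using dist_torus_approx[of "2 * pi * e" x y] d by auto
        obtain k l :: int where
          kl: "v $ i - a $ i = 2 * pi * of_int k" "w $ i - b $ i = 2 * pi * of_int l"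
          using ab vw to_torus_eq_iff unfolding torus_rel_def by metis
        have "\<bar>a $ i - b $ i\<bar> < 2 * pi * e"
          using component_le_norm_cart[of "a - b" i] ab(3) by simp
        moreover have "(v $ i - w $ i) / (2 * pi) = (a $ i - b $ i) / (2 * pi) + of_int (k - l)"
        proof -
          have "v $ i - w $ i = (a $ i - b $ i) + 2 * pi * of_int (k - l)"
            using kl by (simp add: algebra_simps)
          then show ?thesis by (simp add: add_divide_distrib)
        qed
        ultimately have "dist (of_int (k - l)) ((v $ i - w $ i) / (2 * pi)) < e"
          by (simp add: dist_real_def abs_divide divide_simps mult.commute)
        then show "\<exists>y\<in>\<int>. dist y ((v $ i - w $ i) / (2 * pi)) < e"
          using Ints_of_int by blast
      qed
      then have "(v $ i - w $ i) / (2 * pi) \<in> \<int>"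
        by (simp add: closed_Ints closure_closed)
      then obtain k :: int where "(v $ i - w $ i) / (2 * pi) = of_int k"
        by (auto elim: Ints_cases)
      then show "\<exists>k::int. v $ i - w $ i = 2 * pi * of_int k"
        by (auto simp: field_simps)
    qed
    then show "x = y" using vw to_torus_eq_iff by metis
  qed
  show "dist x y \<le> dist x z + dist y z"
  proof (rule field_le_epsilon)
    fix e :: real assume "e > 0"
    then have e: "e / 2 > 0" by simp
    obtain a c where ac: "to_torus a = x" "to_torus c = z" "norm (a - c) < dist x z + e / 2"
      using dist_torus_approx[OF e] by blast
    obtain b c' where bc: "to_torus b = y" "to_torus c' = z" "norm (b - c') < dist y z + e / 2"
      using dist_torus_approx[OF e] by blast
    have "torus_rel c' c" using ac bc to_torus_eq_iff by metis
    then have "torus_rel b (b - c' + c)" unfolding torus_rel_def by simp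
    then have "to_torus (b - c' + c) = y" using bc to_torus_eq_iff by metis
    then have "dist x y \<le> norm (a - (b - c' + c))" using ac dist_torus_le by metis
    also have "\<dots> \<le> norm (a - c) + norm (b - c')"
      using norm_triangle_ineq4[of "a - c" "b - c'"] by (simp add: algebra_simps)
    finally show "dist x y \<le> dist x z + dist y z + e" using ac bc by simp
  qed
qed (simp_all add: uniformity_torus_def open_torus_def)

end

section \<open>Real analytic functions and gradients\<close>

text \<open>Multi-indices are functions \<open>'n \<Rightarrow> nat\<close>; \<open>has_sum\<close> expresses absolute convergence of the
  multivariate power series.\<close>

definition real_analytic :: "(real ^ 'n \<Rightarrow> real) \<Rightarrow> bool" where
  "real_analytic f \<longleftrightarrow>
     (\<forall>v. \<exists>c :: ('n \<Rightarrow> nat) \<Rightarrow> real. \<exists>r>0. \<forall>w\<in>ball v r.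
        ((\<lambda>\<alpha>. c \<alpha> * (\<Prod>i\<in>UNIV. (w $ i - v $ i) ^ \<alpha> i)) has_sum f w) UNIV)"

definition torus_real_analytic :: "('n::finite torus \<Rightarrow> real) \<Rightarrow> bool" where
  "torus_real_analytic Q \<longleftrightarrow> real_analytic (\<lambda>v. Q (to_torus v))"

text \<open>The gradients of the periodic function \<open>\<lambda>v. Q (to_torus v)\<close> at the different representatives of
  a point agree, by periodicity.\<close>

definition torus_gradient :: "('n::finite torus \<Rightarrow> real) \<Rightarrow> 'n torus \<Rightarrow> real ^ 'n" where
  "torus_gradient Q x =
     (THE D. \<forall>v. to_torus v = x \<longrightarrow> (GDERIV (\<lambda>w. Q (to_torus w)) v :> D))"

section \<open>Weak derivatives and Sobolev curves\<close>

definition test_function_on :: "real set \<Rightarrow> (real \<Rightarrow> real) \<Rightarrow> bool" where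
  "test_function_on S \<psi> \<longleftrightarrow>
     \<psi> C1_differentiable_on UNIV \<and> (\<exists>K. compact K \<and> K \<subseteq> S \<and> (\<forall>t. t \<notin> K \<longrightarrow> \<psi> t = 0))"

definition locally_integrable_on :: "real set \<Rightarrow> (real \<Rightarrow> real ^ 'n) \<Rightarrow> bool" where
  "locally_integrable_on S f \<longleftrightarrow> (\<forall>K. compact K \<and> K \<subseteq> S \<longrightarrow> set_integrable lborel K f)"

text \<open>Weak derivatives on an open set \<open>S\<close> of times are taken, as in Brezis' book on Sobolev spaces,
  with respect to compactly supported \<open>C\<^sup>1\<close> test functions; by density, \<open>C\<^sup>\<infinity>\<close> test functions
  give the same notion.\<close>

definition has_weak_deriv_on :: "(real \<Rightarrow> real ^ 'n) \<Rightarrow> (real \<Rightarrow> real ^ 'n) \<Rightarrow> real set \<Rightarrow> bool" where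
  "has_weak_deriv_on \<phi> g S \<longleftrightarrow>
     locally_integrable_on S \<phi> \<and> locally_integrable_on S g \<and>
     (\<forall>\<psi>. test_function_on S \<psi> \<longrightarrow>
        (LINT t:S|lborel. deriv \<psi> t *\<^sub>R \<phi> t) = - (LINT t:S|lborel. \<psi> t *\<^sub>R g t))"

text \<open>The weak derivative of a torus-valued curve is that of a continuous lift; over an interval
  two such lifts of the same curve differ by a constant.\<close>

definition has_torus_weak_deriv_on ::
    "(real \<Rightarrow> 'n::finite torus) \<Rightarrow> (real \<Rightarrow> real ^ 'n) \<Rightarrow> real set \<Rightarrow> bool" where
  "has_torus_weak_deriv_on \<Phi> g S \<longleftrightarrow>
     (\<exists>\<phi>. continuous_on S \<phi> \<and> (\<forall>t\<in>S. to_torus (\<phi> t) = \<Phi> t) \<and> has_weak_deriv_on \<phi> g S)"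

text \<open>Curves on \<open>[0,\<infinity>)\<close> are functions on \<open>real\<close> whose values at negative times are irrelevant.\<close>

definition torus_H1 :: "real \<Rightarrow> (real \<Rightarrow> 'n::finite torus) \<Rightarrow> bool" where
  "torus_H1 T \<Phi> \<longleftrightarrow> continuous_on {0..T} \<Phi> \<and>
     (\<exists>g. has_torus_weak_deriv_on \<Phi> g {0<..<T} \<and>
          set_integrable lborel {0<..<T} (\<lambda>t. (norm (g t))\<^sup>2))"

definition torus_H1_loc :: "(real \<Rightarrow> 'n::finite torus) \<Rightarrow> bool" where
  "torus_H1_loc \<Phi> \<longleftrightarrow> (\<forall>T>0. torus_H1 T \<Phi>)"

text \<open>The velocity is determined almost everywhere on \<open>(0,\<infinity>)\<close>; an arbitrary representative is
  chosen.\<close>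

definition velocity :: "(real \<Rightarrow> 'n::finite torus) \<Rightarrow> real \<Rightarrow> real ^ 'n" where
  "velocity \<Phi> = (SOME g. \<forall>T>0. has_torus_weak_deriv_on \<Phi> g {0<..<T})"

section \<open>The variational problem\<close>

definition lagrangian :: "('n::finite torus \<Rightarrow> real) \<Rightarrow> (real \<Rightarrow> 'n torus) \<Rightarrow> real \<Rightarrow> real" where
  "lagrangian Q \<Phi> t = 1 / 2 * (norm (velocity \<Phi> t))\<^sup>2 + Q (\<Phi> t)"

definition admissible ::
    "('n::finite torus \<Rightarrow> real) \<Rightarrow> 'n torus \<Rightarrow> (real \<Rightarrow> 'n torus) set" where
  "admissible Q \<Phi>0 =
     {\<Phi>. torus_H1_loc \<Phi> \<and> \<Phi> 0 = \<Phi>0 \<and> set_integrable lborel {0<..} (lagrangian Q \<Phi>)}"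

definition action :: "('n::finite torus \<Rightarrow> real) \<Rightarrow> (real \<Rightarrow> 'n torus) \<Rightarrow> real" where
  "action Q \<Phi> = (LINT t:{0<..}|lborel. lagrangian Q \<Phi> t)"

end

theory Submission
  imports Defs
begin

text \<open>Dynamic programming: replacing the minimizer after time \<open>s\<close> by a segment run in unit time to a
  nearest zero of \<open>Q\<close> bounds the remaining action by a multiple of \<open>infdist (\<Phi> s) Z\<close>. Conversely, a
  curve at distance \<open>\<rho>\<close> from \<open>Z\<close> must, within the next unit of time, either move by \<open>\<rho> / 2\<close>, with
  kinetic energy at least of order \<open>\<rho>\<^sup>2\<close>, or stay \<open>\<rho> / 2\<close> away from \<open>Z\<close>, with potential energy at
  least of order \<open>\<rho> powr N\<close>. Comparing the two gives the first estimate from any starting time \<open>s\<close>; the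
  second one starts from the time in \<open>[0, t]\<close> at which \<open>Q (\<Phi> u)\<close> is smallest, hence at most the
  total action divided by \<open>t\<close>.\<close>

section \<open>Gradients of real analytic functions\<close>

text \<open>The obstacle is that \<open>velocity\<close> is an arbitrary choice and that weak
  derivatives see only test functions vanishing near both ends of an open interval. The action of a
  glued curve can be computed from an explicit derivative only once weak derivatives are known to be
  unique almost everywhere. Uniqueness rests on the fundamental theorem of calculus for them, and
  this on an integration by parts whose boundary term is produced by ever steeper cutoffs.

  The constants come from two facts. A segment of length \<delta> run in unit time costs at most
  (\<delta>^2 + L * \<delta>) / 2: its speed is \<delta>, and the Lipschitz bound on Q decreases
  linearly to 0 along it. Distances never exceed 2 pi sqrt n, which makes the first term linear as
  well, whence the factor (2 pi sqrt n + L) / 2. The same bound lifts the exponents 2 and N to their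
  maximum N', whence the powers of 2 pi sqrt n in \<sigma>1.\<close>

text \<open>No termwise differentiation: absolute convergence at the single point
  \<open>v + vec \<rho>\<close> dominates the terms of degree at least 2 at a point \<open>w\<close>
  nearer than \<rho> by \<open>(norm (w - v) / \<rho>)\<^sup>2\<close> times a convergent series.
  They sum to a quadratic remainder, so the coefficients of degree 1 form the gradient.\<close>

lemma real_analytic_has_gradient:
  fixes f :: "real ^ 'n::finite \<Rightarrow> real"
  assumes "real_analytic f"
  shows "\<exists>D. GDERIV f v :> D"
proof -
  obtain c :: "('n \<Rightarrow> nat) \<Rightarrow> real" and r where r: "r > 0"
    and c: "\<And>w. w \<in> ball v r \<Longrightarrow>
        ((\<lambda>\<alpha>. c \<alpha> * (\<Prod>i\<in>UNIV. (w $ i - v $ i) ^ \<alpha> i)) has_sum f w) UNIV"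
    using assms unfolding real_analytic_def by blast
  define a where "a \<alpha> w = c \<alpha> * (\<Prod>i\<in>UNIV. (w $ i - v $ i) ^ \<alpha> i)" for \<alpha> w
  \<comment> \<open>Makes the l1 norm of \<open>vec \<rho>\<close> equal to r / 2, which keeps
    \<open>v + vec \<rho>\<close> inside the ball in every dimension.\<close>
  define \<rho> where "\<rho> = r / (2 * real CARD('n))"
  have \<rho>: "\<rho> > 0" using r by (simp add: \<rho>_def)
  have "norm (vec \<rho> :: real ^ 'n) \<le> (\<Sum>i\<in>(UNIV :: 'n set). \<bar>\<rho>\<bar>)"
    using norm_le_l1_cart[of "vec \<rho> :: real ^ 'n"] by simp
  also have "\<dots> = r / 2" using r by (simp add: \<rho>_def)
  also have "\<dots> < r" using r by simp
  finally have "v + vec \<rho> \<in> ball v r" by (simp add: dist_norm)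
  from c[OF this] have "(\<lambda>\<alpha>. c \<alpha> * \<rho> ^ sum \<alpha> UNIV) summable_on UNIV"
    by (auto simp: power_sum summable_on_def)
  then have abs_c: "(\<lambda>\<alpha>. \<bar>c \<alpha>\<bar> * \<rho> ^ sum \<alpha> UNIV) summable_on UNIV"
    using \<rho> by (subst (asm) summable_on_iff_abs_summable_on_real) (simp add: abs_mult)
  define e where "e i = (\<lambda>j. if j = i then 1 else 0 :: nat)" for i :: 'n
  \<comment> \<open>The multi-indices of degree at most 1; the fact \<open>deg\<close> below shows
    that all others have degree at least 2.\<close>
  define F where "F = insert (\<lambda>_. 0) (range e)"
  have F: "finite F" by (simp add: F_def)
  define C where "C = (\<Sum>\<^sub>\<infinity>\<alpha>\<in>-F. \<bar>c \<alpha>\<bar> * \<rho> ^ sum \<alpha> UNIV) / \<rho>\<^sup>2"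
  define D :: "real ^ 'n" where "D = (\<chi> i. c (e i))"
  have abs_c': "(\<lambda>\<alpha>. \<bar>c \<alpha>\<bar> * \<rho> ^ sum \<alpha> UNIV) summable_on -F"
    using abs_c by (rule summable_on_subset_banach) simp
  have C: "C \<ge> 0" unfolding C_def using \<rho> by (intro divide_nonneg_nonneg infsum_nonneg) auto
  have deg: "sum \<alpha> UNIV \<ge> 2" if "\<alpha> \<notin> F" for \<alpha>
  proof (rule ccontr)
    assume "\<not> ?thesis"
    then consider "sum \<alpha> UNIV = 0" | "sum \<alpha> UNIV = 1" by linarith
    then show False
    proof cases
      case 1
      then have "\<alpha> = (\<lambda>_. 0)" by auto
      with that show False by (simp add: F_def)
    next
      case 2
      then obtain i where "\<alpha> i = 1" "\<And>j. i \<noteq> j \<Longrightarrow> \<alpha> j = 0"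
        using sum_eq_1_iff[of "UNIV :: 'n set" \<alpha>] by auto
      then have "\<alpha> = e i" by (auto simp: e_def)
      with that show False by (simp add: F_def)
    qed
  qed
  have bound: "\<bar>f w - c (\<lambda>_. 0) - inner (w - v) D\<bar> \<le> C * (norm (w - v))\<^sup>2"
    if w: "norm (w - v) < \<rho>" for w
  proof -
    define \<delta> where "\<delta> = norm (w - v)"
    have \<delta>: "0 \<le> \<delta>" "\<delta> < \<rho>" using w by (auto simp: \<delta>_def)
    have "real CARD('n) \<ge> 1" by (simp add: Suc_le_eq)
    then have "\<rho> \<le> r / 2"
      using r frac_le[of r r 2 "2 * real CARD('n)"] by (simp add: \<rho>_def)
    then have "w \<in> ball v r" using \<delta> r by (simp add: \<delta>_def dist_norm norm_minus_commute)
    then have s: "((\<lambda>\<alpha>. a \<alpha> w) has_sum f w) UNIV" using c by (simp add: a_def)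
    then have s': "(\<lambda>\<alpha>. a \<alpha> w) summable_on -F"
      by (meson summable_on_def summable_on_subset_banach subset_UNIV)
    have "((\<lambda>\<alpha>. a \<alpha> w) has_sum ((\<Sum>\<alpha>\<in>F. a \<alpha> w) + (\<Sum>\<^sub>\<infinity>\<alpha>\<in>-F. a \<alpha> w))) (F \<union> - F)"
      using F s' by (intro has_sum_Un_disjoint has_sum_finite has_sum_infsum) auto
    with s have split: "f w = (\<Sum>\<alpha>\<in>F. a \<alpha> w) + (\<Sum>\<^sub>\<infinity>\<alpha>\<in>-F. a \<alpha> w)"
      by (auto dest: has_sum_unique)
    have inj: "inj e" by (auto simp: inj_def e_def fun_eq_iff split: if_splits)
    have "(\<lambda>_. 0) \<notin> range e" by (metis (lifting) e_def rangeE zero_neq_one)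
    then have "(\<Sum>\<alpha>\<in>F. a \<alpha> w) = a (\<lambda>_. 0) w + (\<Sum>i\<in>UNIV. a (e i) w)"
      using inj by (simp add: F_def sum.reindex)
    moreover have "a (e i) w = c (e i) * (w $ i - v $ i)" for i
    proof -
      have "(w $ j - v $ j) ^ e i j = (if j = i then w $ i - v $ i else 1)" for j
        by (simp add: e_def)
      then show ?thesis by (simp add: a_def)
    qed
    moreover have "a (\<lambda>_. 0) w = c (\<lambda>_. 0)" by (simp add: a_def)
    ultimately have "(\<Sum>\<alpha>\<in>F. a \<alpha> w) = c (\<lambda>_. 0) + inner (w - v) D"
      by (simp add: D_def inner_vec_def mult.commute)
    with split have "f w - c (\<lambda>_. 0) - inner (w - v) D = (\<Sum>\<^sub>\<infinity>\<alpha>\<in>-F. a \<alpha> w)" by simp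
    also have "\<bar>\<dots>\<bar> \<le> (\<Sum>\<^sub>\<infinity>\<alpha>\<in>-F. \<bar>a \<alpha> w\<bar>)"
      using norm_infsum_bound[OF s'[THEN summable_on_iff_abs_summable_on_real[THEN iffD1]]] by simp
    also have "\<dots> \<le> (\<Sum>\<^sub>\<infinity>\<alpha>\<in>-F. (\<delta> / \<rho>)\<^sup>2 * (\<bar>c \<alpha>\<bar> * \<rho> ^ sum \<alpha> UNIV))"
    proof (rule infsum_mono)
      show "(\<lambda>\<alpha>. \<bar>a \<alpha> w\<bar>) summable_on - F"
        using s' by (subst (asm) summable_on_iff_abs_summable_on_real) simp
      show "(\<lambda>\<alpha>. (\<delta> / \<rho>)\<^sup>2 * (\<bar>c \<alpha>\<bar> * \<rho> ^ sum \<alpha> UNIV)) summable_on - F"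
        by (intro summable_on_cmult_right abs_c')
      fix \<alpha> assume "\<alpha> \<in> - F"
      have "\<bar>\<Prod>i\<in>UNIV. (w $ i - v $ i) ^ \<alpha> i\<bar> \<le> (\<Prod>i\<in>UNIV. \<delta> ^ \<alpha> i)"
        unfolding abs_prod
      proof (rule prod_mono)
        fix i
        have "\<bar>w $ i - v $ i\<bar> \<le> \<delta>"
          using component_le_norm_cart[of "w - v" i] by (simp add: \<delta>_def)
        then show "0 \<le> \<bar>(w $ i - v $ i) ^ \<alpha> i\<bar> \<and> \<bar>(w $ i - v $ i) ^ \<alpha> i\<bar> \<le> \<delta> ^ \<alpha> i"
          by (simp add: power_abs power_mono)
      qed
      also have "\<dots> = (\<delta> / \<rho>) ^ sum \<alpha> UNIV * \<rho> ^ sum \<alpha> UNIV"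
        using \<rho> by (simp add: power_sum[symmetric] power_divide)
      also have "\<dots> \<le> (\<delta> / \<rho>)\<^sup>2 * \<rho> ^ sum \<alpha> UNIV"
        using \<rho> \<delta> deg[of \<alpha>] \<open>\<alpha> \<in> - F\<close>
        by (intro mult_right_mono power_decreasing) auto
      finally have "\<bar>c \<alpha>\<bar> * \<bar>\<Prod>i\<in>UNIV. (w $ i - v $ i) ^ \<alpha> i\<bar>
          \<le> \<bar>c \<alpha>\<bar> * ((\<delta> / \<rho>)\<^sup>2 * \<rho> ^ sum \<alpha> UNIV)"
        by (intro mult_left_mono) auto
      then show "\<bar>a \<alpha> w\<bar> \<le> (\<delta> / \<rho>)\<^sup>2 * (\<bar>c \<alpha>\<bar> * \<rho> ^ sum \<alpha> UNIV)"
        by (simp add: a_def abs_mult mult_ac)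
    qed
    also have "\<dots> = C * \<delta>\<^sup>2"
      using infsum_cmult_right[OF abs_c', of "(\<delta> / \<rho>)\<^sup>2"] by (simp add: C_def power_divide mult.commute)
    finally show ?thesis by (simp add: \<delta>_def)
  qed
  have fv: "f v = c (\<lambda>_. 0)" using bound[of v] \<rho> by simp
  have "(f has_derivative (\<lambda>h. inner h D)) (at v)"
    unfolding has_derivative_at_alt
  proof (intro conjI allI impI)
    show "bounded_linear (\<lambda>h. inner h D)" by (rule bounded_linear_inner_left)
    fix \<epsilon> :: real assume \<epsilon>: "\<epsilon> > 0"
    show "\<exists>d>0. \<forall>y. norm (y - v) < d \<longrightarrow>
        norm (f y - f v - inner (y - v) D) \<le> \<epsilon> * norm (y - v)"
    \<comment> \<open>\<open>C + 1\<close> instead of \<open>C\<close> keeps the radius positive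
      when \<open>C = 0\<close>.\<close>
    proof (intro exI[of _ "min \<rho> (\<epsilon> / (C + 1))"] conjI allI impI)
      show "0 < min \<rho> (\<epsilon> / (C + 1))" using \<epsilon> \<rho> C by simp
      fix y assume y: "norm (y - v) < min \<rho> (\<epsilon> / (C + 1))"
      then have "(C + 1) * norm (y - v) \<le> \<epsilon>" using C by (simp add: field_simps)
      moreover have "C * norm (y - v) \<le> (C + 1) * norm (y - v)" by (intro mult_right_mono) auto
      ultimately have "C * norm (y - v) \<le> \<epsilon>" by linarith
      from mult_right_mono[OF this norm_ge_zero[of "y - v"]] bound[of y] y
      show "norm (f y - f v - inner (y - v) D) \<le> \<epsilon> * norm (y - v)"
        by (simp add: fv power2_eq_square mult.assoc)
    qed
  qed
  then show ?thesis by (auto simp: gderiv_def)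
qed

lemma GDERIV_unique: "GDERIV f x :> D \<Longrightarrow> GDERIV f x :> D' \<Longrightarrow> D = D'"
  unfolding gderiv_def
  by (metis (no_types, lifting) has_derivative_unique vector_eq_ldot[of D D'])

text \<open>\<open>torus_gradient\<close> is a definite description, so one vector must serve all
  representatives of the point. Two of them differ by a period, and translation by a period does not
  change the lifted function.\<close>

lemma torus_gradient_GDERIV:
  assumes "torus_real_analytic Q"
  shows "GDERIV (\<lambda>w. Q (to_torus w)) v :> torus_gradient Q (to_torus v)"
proof -
  obtain D where D: "GDERIV (\<lambda>w. Q (to_torus w)) v :> D"
    using assms real_analytic_has_gradient unfolding torus_real_analytic_def by blast
  have D': "GDERIV (\<lambda>w. Q (to_torus w)) v' :> D" if "to_torus v' = to_torus v" for v'
  proof -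
    have "torus_rel (w + (v - v')) w" for w
      using that[symmetric] by (simp add: to_torus_eq_iff torus_rel_def)
    then have shift: "Q (to_torus (w + (v - v'))) = Q (to_torus w)" for w
      by (metis to_torus_eq_iff)
    have "((\<lambda>w. Q (to_torus (w + (v - v')))) has_derivative (\<lambda>h. inner h D)) (at v')"
      by (rule has_derivative_compose[of "\<lambda>w. w + (v - v')" "\<lambda>h. h" v' UNIV
            "\<lambda>w. Q (to_torus w)", simplified])
        (use D in \<open>auto intro!: derivative_eq_intros simp: gderiv_def\<close>)
    then show ?thesis by (simp add: shift gderiv_def)
  qed
  have "torus_gradient Q (to_torus v) = D"
    unfolding torus_gradient_def by (rule the_equality) (use D D' GDERIV_unique in blast)+
  with D show ?thesis by simp
qed

text \<open>The mean value inequality on the whole space, which is convex. With arbitrary lifts it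
  applies both to a straight segment and to nearly optimal representatives.\<close>

lemma torus_gradient_bound_imp_Lipschitz:
  assumes "torus_real_analytic Q" "\<And>x. norm (torus_gradient Q x) \<le> L"
  shows "\<bar>Q (to_torus v) - Q (to_torus w)\<bar> \<le> L * norm (v - w)"
proof -
  have "norm (Q (to_torus v) - Q (to_torus w)) \<le> L * norm (v - w)"
  proof (rule differentiable_bound[of UNIV "\<lambda>w. Q (to_torus w)"
        "\<lambda>v h. inner h (torus_gradient Q (to_torus v))"])
    show "onorm (\<lambda>h. inner h (torus_gradient Q (to_torus x))) \<le> L" for x
      by (rule onorm_le)
        (metis Cauchy_Schwarz_ineq2 assms(2) mult.commute mult_right_mono norm_ge_zero
          order_trans real_norm_def)
  qed (use torus_gradient_GDERIV[OF assms(1)] in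
      \<open>auto simp: gderiv_def intro: has_derivative_at_withinI\<close>)
  then show ?thesis by simp
qed

section \<open>Cutoffs and set integrals\<close>

text \<open>A quadratic spline rising from 0 at 0 to 1 at 1; its derivative is the tent of height 2
  over [0, 1]. It is C1, exactly the regularity asked of test functions.\<close>

definition smooth_step :: "real \<Rightarrow> real" where
  "smooth_step x = 2 * (max 0 x)\<^sup>2 - 4 * (max 0 (x - 1/2))\<^sup>2 + 2 * (max 0 (x - 1))\<^sup>2"

definition smooth_step_deriv :: "real \<Rightarrow> real" where
  "smooth_step_deriv x = 4 * max 0 x - 8 * max 0 (x - 1/2) + 4 * max 0 (x - 1)"

lemma DERIV_square_max_0: "((\<lambda>x. (max 0 x)\<^sup>2) has_real_derivative 2 * max 0 x) (at x)" for x :: real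
proof -
  consider "x < 0" | "x > 0" | "x = 0" by linarith
  then show ?thesis
  proof cases
    case 1
    have "((\<lambda>x. (max 0 x)\<^sup>2) has_real_derivative 0) (at x)"
      by (rule has_field_derivative_transform_within_open[of "\<lambda>x. 0" _ _ "{..<0}"]) (use 1 in auto)
    with 1 show ?thesis by simp
  next
    case 2
    have "((\<lambda>x. x\<^sup>2) has_real_derivative 2 * x) (at x)" by (auto intro!: derivative_eq_intros)
    then have "((\<lambda>x. (max 0 x)\<^sup>2) has_real_derivative 2 * x) (at x)"
      by (rule has_field_derivative_transform_within_open[of _ _ _ "{0<..}"]) (use 2 in auto)
    with 2 show ?thesis by simp
  next
    case 3
    have "((\<lambda>h. ((max 0 h)\<^sup>2 - 0) / h) \<longlongrightarrow> 0) (at (0::real))"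
    proof (rule Lim_null_comparison)
      show "\<forall>\<^sub>F h in at (0::real). norm (((max 0 h)\<^sup>2 - 0) / h) \<le> \<bar>h\<bar>"
        by (auto simp: max_def power2_eq_square intro!: always_eventually)
      show "(abs \<longlongrightarrow> 0) (at (0::real))" by (auto intro!: tendsto_eq_intros)
    qed
    with 3 show ?thesis by (simp add: DERIV_def)
  qed
qed

lemma DERIV_smooth_step: "(smooth_step has_real_derivative smooth_step_deriv x) (at x)"
proof -
  have "((\<lambda>x. (max 0 (x - c))\<^sup>2) has_real_derivative 2 * max 0 (x - c)) (at x)" for c
    using DERIV_chain2[OF DERIV_square_max_0 DERIV_diff[OF DERIV_ident DERIV_const]] by simp
  note this[of 0, simplified, derivative_intros] this[of 1, derivative_intros]
    this[of "1/2", derivative_intros]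
  show ?thesis
    unfolding smooth_step_def smooth_step_deriv_def by (auto intro!: derivative_eq_intros)
qed

lemma smooth_step_le_0: "x \<le> 0 \<Longrightarrow> smooth_step x = 0"
  and smooth_step_deriv_le_0: "x \<le> 0 \<Longrightarrow> smooth_step_deriv x = 0"
  and smooth_step_ge_1: "x \<ge> 1 \<Longrightarrow> smooth_step x = 1"
  and smooth_step_deriv_ge_1: "x \<ge> 1 \<Longrightarrow> smooth_step_deriv x = 0"
  by (simp_all add: smooth_step_def smooth_step_deriv_def max_def power2_eq_square algebra_simps)

lemma smooth_step_deriv_nonneg: "smooth_step_deriv x \<ge> 0"
  by (simp add: smooth_step_deriv_def max_def)

lemma smooth_step_mono: "x \<le> y \<Longrightarrow> smooth_step x \<le> smooth_step y"
  by (rule DERIV_nonneg_imp_nondecreasing) (use DERIV_smooth_step smooth_step_deriv_nonneg in blast)+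

lemma smooth_step_bounds: "0 \<le> smooth_step x" "smooth_step x \<le> 1"
  using smooth_step_mono[of "min 0 x" x] smooth_step_mono[of x "max 1 x"]
  by (simp_all add: smooth_step_le_0 smooth_step_ge_1)

lemma continuous_on_smooth_step [continuous_intros]:
  "continuous_on A f \<Longrightarrow> continuous_on A (\<lambda>x. smooth_step (f x))"
  "continuous_on A f \<Longrightarrow> continuous_on A (\<lambda>x. smooth_step_deriv (f x))"
  by (auto simp: smooth_step_def smooth_step_deriv_def intro!: continuous_intros)

section \<open>Set integrals and limits against cutoffs\<close>

lemma set_integrable_compact_continuous:
  fixes f :: "real \<Rightarrow> 'b::{banach, second_countable_topology}"
  shows "compact S \<Longrightarrow> continuous_on S f \<Longrightarrow> set_integrable lborel S f"
  unfolding set_integrable_def by (rule borel_integrable_compact)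

text \<open>Continuity bounds \<open>h\<close> on the compact set by some \<open>B\<close>, so
  \<open>B *\<^sub>R f\<close> dominates. This is meant for \<open>f\<close> a weak derivative,
  which is only locally integrable.\<close>

lemma set_integrable_continuous_scaleR:
  fixes f :: "real \<Rightarrow> 'b::{banach, second_countable_topology}" and h :: "real \<Rightarrow> real"
  assumes J: "compact J" and h: "continuous_on J h" and f: "set_integrable lborel J f"
  shows "set_integrable lborel J (\<lambda>t. h t *\<^sub>R f t)"
proof -
  obtain B where B: "\<And>t. t \<in> J \<Longrightarrow> norm (h t) \<le> B"
    using compact_imp_bounded[OF compact_continuous_image[OF h J]] by (auto simp: bounded_iff)
  have "(\<lambda>t. (indicator J t *\<^sub>R h t) *\<^sub>R (indicator J t *\<^sub>R f t)) \<in> borel_measurable lborel"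
    using f set_integrable_compact_continuous[OF J h]
    by (intro borel_measurable_scaleR borel_measurable_integrable) (auto simp: set_integrable_def)
  moreover have "(\<lambda>t. (indicator J t *\<^sub>R h t) *\<^sub>R (indicator J t *\<^sub>R f t))
      = (\<lambda>t. indicator J t *\<^sub>R (h t *\<^sub>R f t))"
    by (auto simp: fun_eq_iff split: split_indicator)
  ultimately have "set_borel_measurable lborel J (\<lambda>t. h t *\<^sub>R f t)"
    by (simp add: set_borel_measurable_def)
  then show ?thesis
  proof (rule set_integrable_bound[of _ _ "\<lambda>t. B *\<^sub>R f t", rotated])
    show "AE x in lborel. x \<in> J \<longrightarrow> norm (h x *\<^sub>R f x) \<le> norm (B *\<^sub>R f x)"
      using B by (auto intro!: AE_I2 mult_right_mono order_trans[OF _ abs_ge_self])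
    show "set_integrable lborel J (\<lambda>t. B *\<^sub>R f t)"
      using f by (cases "B = 0") (simp_all add: set_integrable_def[of _ _ "\<lambda>_. 0"])
  qed
qed

text \<open>Moves integrals against test functions between an open interval, a compact set carrying
  the support, and half-open intervals ending at a prescribed time.\<close>

lemma LINT_support_eq:
  fixes f :: "real \<Rightarrow> 'b::{banach, second_countable_topology}"
  assumes "J \<subseteq> S" "\<And>t. t \<in> S \<Longrightarrow> t \<notin> J \<Longrightarrow> f t = 0"
  shows "(LINT t:S|lborel. f t) = (LINT t:J|lborel. f t)"
proof -
  have "indicator S t *\<^sub>R f t = indicator J t *\<^sub>R f t" for t
    using assms by (auto split: split_indicator)
  then show ?thesis unfolding set_lebesgue_integral_def by (rule Bochner_Integration.integral_cong[OF refl])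
qed

lemma set_integrable_support:
  fixes f :: "real \<Rightarrow> 'b::{banach, second_countable_topology}"
  assumes "set_integrable lborel J f" "J \<subseteq> S" "\<And>t. t \<in> S \<Longrightarrow> t \<notin> J \<Longrightarrow> f t = 0"
  shows "set_integrable lborel S f"
proof -
  have "(\<lambda>t. indicator J t *\<^sub>R f t) = (\<lambda>t. indicator S t *\<^sub>R f t)"
    using assms(2,3) by (auto split: split_indicator simp: fun_eq_iff)
  with assms(1) show ?thesis by (simp only: set_integrable_def)
qed

text \<open>Dominated convergence: the factors lie between 0 and 1 and, at each
  \<open>t < s\<close>, are eventually equal to 1.\<close>

lemma LINT_smooth_step_tendsto:
  fixes f :: "real \<Rightarrow> 'b::{banach, second_countable_topology}"
  assumes f: "set_integrable lborel {a..s} f"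
  shows "(\<lambda>k. LINT t:{a..s}|lborel. smooth_step ((s - t) * real k) *\<^sub>R f t)
    \<longlonglongrightarrow> (LINT t:{a..s}|lborel. f t)"
  unfolding set_lebesgue_integral_def
proof (rule integral_dominated_convergence)
  show int: "integrable lborel (\<lambda>t. norm (indicator {a..s} t *\<^sub>R f t))"
    using f unfolding set_integrable_def by (rule integrable_norm)
  show "(\<lambda>t. indicator {a..s} t *\<^sub>R f t) \<in> borel_measurable lborel"
    using f by (auto simp: set_integrable_def)
  have "set_integrable lborel {a..s} (\<lambda>t. smooth_step ((s - t) * real k) *\<^sub>R f t)" for k
    by (intro set_integrable_continuous_scaleR f continuous_intros) auto
  then show "(\<lambda>t. indicator {a..s} t *\<^sub>R smooth_step ((s - t) * real k) *\<^sub>R f t)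
      \<in> borel_measurable lborel" for k
    by (auto simp: set_integrable_def)
  show "AE t in lborel. norm (indicator {a..s} t *\<^sub>R smooth_step ((s - t) * real k) *\<^sub>R f t)
      \<le> norm (indicator {a..s} t *\<^sub>R f t)" for k
    using smooth_step_bounds
    by (intro AE_I2) (auto split: split_indicator intro!: mult_left_le_one_le)
  show "AE t in lborel. (\<lambda>k. indicator {a..s} t *\<^sub>R smooth_step ((s - t) * real k) *\<^sub>R f t)
      \<longlonglongrightarrow> indicator {a..s} t *\<^sub>R f t"
  \<comment> \<open>At \<open>t = s\<close> the factor is 0 for every \<open>k\<close>, so this
    point is excluded as a null set.\<close>
  proof (rule AE_mp[OF AE_lborel_singleton[of s]], intro AE_I2 impI)
    fix t assume "t \<noteq> s"
    show "(\<lambda>k. indicator {a..s} t *\<^sub>R smooth_step ((s - t) * real k) *\<^sub>R f t)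
      \<longlonglongrightarrow> indicator {a..s} t *\<^sub>R f t"
    proof (cases "t \<in> {a..s}")
      case True
      with \<open>t \<noteq> s\<close> have "s - t > 0" by simp
      then obtain m where m: "1 \<le> (s - t) * real m"
        by (metis mult.commute order_less_imp_le reals_Archimedean3)
      have "\<forall>\<^sub>F k in sequentially. smooth_step ((s - t) * real k) = 1"
        using eventually_ge_at_top[of m]
      proof eventually_elim
        case (elim k)
        then have "(s - t) * real m \<le> (s - t) * real k"
          using \<open>s - t > 0\<close> by (intro mult_left_mono) auto
        with m show ?case by (intro smooth_step_ge_1) simp
      qed
      then have "\<forall>\<^sub>F k in sequentially.
          indicator {a..s} t *\<^sub>R smooth_step ((s - t) * real k) *\<^sub>R f t = indicator {a..s} t *\<^sub>R f t"
        by eventually_elim simp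
      then show ?thesis by (rule tendsto_eventually)
    qed auto
  qed
qed

text \<open>An approximate identity to the left of \<open>s\<close>: the kernel is nonnegative,
  lives on [s - 1/k, s] and has mass 1 once this interval lies in [a, s].\<close>

lemma LINT_smooth_step_deriv_tendsto:
  fixes F :: "real \<Rightarrow> 'b::euclidean_space"
  assumes F: "continuous_on {a..s} F" and "a < s"
  shows "(\<lambda>k. LINT t:{a..s}|lborel. (real k * smooth_step_deriv ((s - t) * real k)) *\<^sub>R F t)
    \<longlonglongrightarrow> F s"
proof (rule LIMSEQ_I)
  fix r :: real assume "r > 0"
  then have r: "r / 2 > 0" by simp
  with F \<open>a < s\<close> obtain \<eta> where \<eta>: "\<eta> > 0"
    "\<And>t. t \<in> {a..s} \<Longrightarrow> dist t s < \<eta> \<Longrightarrow> dist (F t) (F s) < r / 2"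
    unfolding continuous_on_iff by (metis atLeastAtMost_iff order_less_imp_le order_refl)
  \<comment> \<open>The bound \<open>s - a\<close> makes the kernel fit into the interval once
    \<open>real k * \<epsilon> > 1\<close>, so its mass is exactly 1.\<close>
  define \<epsilon> where "\<epsilon> = min \<eta> (s - a)"
  have \<epsilon>: "\<epsilon> > 0" "\<epsilon> \<le> \<eta>" "\<epsilon> \<le> s - a" using \<eta>(1) \<open>a < s\<close> by (auto simp: \<epsilon>_def)
  then obtain m where m: "1 < real m * \<epsilon>" using reals_Archimedean3 by blast
  show "\<exists>m. \<forall>k\<ge>m. norm ((LINT t:{a..s}|lborel.
      (real k * smooth_step_deriv ((s - t) * real k)) *\<^sub>R F t) - F s) < r"
  proof (intro exI[of _ m] allI impI)
    fix k assume "k \<ge> m"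
    then have "real m * \<epsilon> \<le> real k * \<epsilon>" using \<epsilon> by (intro mult_right_mono) auto
    with m have k: "1 < real k * \<epsilon>" by simp
    define \<kappa> where "\<kappa> t = real k * smooth_step_deriv ((s - t) * real k)" for t
    have \<kappa>_cont: "continuous_on {a..s} \<kappa>" unfolding \<kappa>_def by (intro continuous_intros)
    have \<kappa>_nonneg: "\<kappa> t \<ge> 0" for t by (simp add: \<kappa>_def smooth_step_deriv_nonneg)
    have "((\<lambda>t. - smooth_step ((s - t) * real k)) has_real_derivative \<kappa> t) (at t within {a..s})"
      for t unfolding \<kappa>_def
      by (auto intro!: derivative_eq_intros DERIV_chain2[OF DERIV_smooth_step])
    then have "(LINT t:{a..s}|lborel. \<kappa> t) =
        - smooth_step ((s - s) * real k) - - smooth_step ((s - a) * real k)"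
      unfolding set_lebesgue_integral_def using \<open>a < s\<close> \<kappa>_cont
      by (intro integral_FTC_atLeastAtMost) (auto simp: has_real_derivative_iff_has_vector_derivative)
    moreover have "1 \<le> (s - a) * real k"
    proof -
      have "real k * \<epsilon> \<le> real k * (s - a)" using \<epsilon> by (intro mult_left_mono) auto
      with k show ?thesis by (simp add: mult.commute)
    qed
    ultimately have \<kappa>_int: "(LINT t:{a..s}|lborel. \<kappa> t) = 1"
      by (simp add: smooth_step_le_0 smooth_step_ge_1)
    have "(LINT t:{a..s}|lborel. \<kappa> t *\<^sub>R F t) - F s
        = (LINT t:{a..s}|lborel. \<kappa> t *\<^sub>R F t) - (LINT t:{a..s}|lborel. \<kappa> t *\<^sub>R F s)"
      using \<kappa>_int set_integrable_compact_continuous[OF compact_Icc \<kappa>_cont]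
      by (simp add: set_lebesgue_integral_def set_integrable_def)
    also have "\<dots> = (LINT t:{a..s}|lborel. \<kappa> t *\<^sub>R F t - \<kappa> t *\<^sub>R F s)"
      by (intro set_integral_diff(2)[symmetric] set_integrable_compact_continuous continuous_intros
          F \<kappa>_cont) auto
    also have "norm \<dots> \<le> (LINT t:{a..s}|lborel. norm (\<kappa> t *\<^sub>R F t - \<kappa> t *\<^sub>R F s))"
      by (intro set_integral_norm_bound set_integrable_compact_continuous continuous_intros
          F \<kappa>_cont) auto
    also have "\<dots> \<le> (LINT t:{a..s}|lborel. \<kappa> t * (r / 2))"
    proof (rule set_integral_mono)
      fix t assume t: "t \<in> {a..s}"
      have "\<kappa> t * norm (F t - F s) \<le> \<kappa> t * (r / 2)"
      \<comment> \<open>Nearer than \<epsilon> the continuity of \<open>F\<close> at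
        \<open>s\<close> applies; farther away the kernel vanishes.\<close>
      proof (cases "s - t < \<epsilon>")
        case True
        then have "norm (F t - F s) \<le> r / 2"
          using \<eta>(2)[OF t] t \<epsilon> by (auto simp: dist_norm)
        then show ?thesis using \<kappa>_nonneg by (intro mult_left_mono)
      next
        case False
        then have "real k * \<epsilon> \<le> real k * (s - t)" by (intro mult_left_mono) auto
        with k have "(s - t) * real k \<ge> 1" by (simp add: mult.commute)
        then show ?thesis by (simp add: \<kappa>_def smooth_step_deriv_ge_1)
      qed
      then show "norm (\<kappa> t *\<^sub>R F t - \<kappa> t *\<^sub>R F s) \<le> \<kappa> t * (r / 2)"
        using \<kappa>_nonneg[of t] by (simp add: scaleR_diff_right[symmetric])
    qed (intro set_integrable_compact_continuous continuous_intros F \<kappa>_cont compact_Icc)+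
    also have "\<dots> = r / 2" using \<kappa>_int by simp
    finally show "norm ((LINT t:{a..s}|lborel.
        (real k * smooth_step_deriv ((s - t) * real k)) *\<^sub>R F t) - F s) < r"
      using \<open>r > 0\<close> by (simp add: \<kappa>_def)
  qed
qed

section \<open>Weak derivatives\<close>

lemma test_function_onE:
  assumes "test_function_on S \<psi>"
  obtains K where "compact K" "K \<subseteq> S" "\<And>t. t \<notin> K \<Longrightarrow> \<psi> t = 0" "\<And>t. t \<notin> K \<Longrightarrow> deriv \<psi> t = 0"
    "\<And>t. (\<psi> has_real_derivative deriv \<psi> t) (at t)"
    "continuous_on UNIV \<psi>" "continuous_on UNIV (deriv \<psi>)"
proof -
  obtain K D where K: "compact K" "K \<subseteq> S" "\<And>t. t \<notin> K \<Longrightarrow> \<psi> t = 0"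
    and D: "\<And>t. (\<psi> has_real_derivative D t) (at t)" "continuous_on UNIV D"
    using assms unfolding test_function_on_def C1_differentiable_on_def
      has_real_derivative_iff_has_vector_derivative by auto
  have D_eq: "deriv \<psi> = D" using D(1) by (auto intro: DERIV_imp_deriv)
  have "deriv \<psi> t = 0" if "t \<notin> K" for t
  proof -
    have "(\<psi> has_real_derivative 0) (at t)"
      by (rule has_field_derivative_transform_within_open[of "\<lambda>_. 0" _ _ "- K"])
        (use that K compact_imp_closed in auto)
    then show ?thesis by (rule DERIV_imp_deriv)
  qed
  moreover have "continuous_on UNIV \<psi>"
    using D(1) DERIV_isCont continuous_at_imp_continuous_on by blast
  ultimately show ?thesis using that[OF K] D D_eq by simp
qed

lemma test_function_onI:
  assumes "compact K" "K \<subseteq> S" "\<And>t. t \<notin> K \<Longrightarrow> \<psi> t = 0"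
    and "\<And>t. (\<psi> has_real_derivative D t) (at t)" "continuous_on UNIV D"
  shows "test_function_on S \<psi>"
  using assms unfolding test_function_on_def C1_differentiable_on_def
    has_real_derivative_iff_has_vector_derivative by blast

lemma compact_positive_lower_bound:
  fixes K :: "real set"
  assumes "compact K" "K \<subseteq> {0<..}"
  obtains \<delta> where "\<delta> > 0" "K \<subseteq> {\<delta>..}"
proof (cases "K = {}")
  case False
  then show ?thesis using compact_attains_inf[OF assms(1)] assms(2) that by (metis atLeast_iff
        greaterThan_iff subset_eq)
qed (use that[of 1] in auto)

text \<open>The test function may be nonzero at \<open>s\<close>. Multiplied by a cutoff that
  vanishes after \<open>s\<close>, it becomes a test function on (0, T). As the cutoff steepens, its
  derivative acts as an approximate identity at \<open>s\<close> and leaves the boundary term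
  \<open>\<psi> s *\<^sub>R \<phi> s\<close>.\<close>

lemma weak_deriv_by_parts:
  fixes \<phi> g :: "real \<Rightarrow> real ^ 'n"
  assumes weak: "has_weak_deriv_on \<phi> g {0<..<T}" and \<phi>: "continuous_on {0<..<T} \<phi>"
    and test: "test_function_on {0<..} \<psi>" and s: "0 < s" "s < T"
  shows "(LINT t:{0<..s}|lborel. deriv \<psi> t *\<^sub>R \<phi> t) =
    \<psi> s *\<^sub>R \<phi> s - (LINT t:{0<..s}|lborel. \<psi> t *\<^sub>R g t)"
proof -
  obtain K where K: "compact K" "K \<subseteq> {0<..}" "\<And>t. t \<notin> K \<Longrightarrow> \<psi> t = 0" "\<And>t. t \<notin> K \<Longrightarrow> deriv \<psi> t = 0"
    and \<psi>: "\<And>t. (\<psi> has_real_derivative deriv \<psi> t) (at t)"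
      "continuous_on UNIV \<psi>" "continuous_on UNIV (deriv \<psi>)"
    by (rule test_function_onE[OF test]) blast
  obtain \<delta>' where \<delta>': "\<delta>' > 0" "K \<subseteq> {\<delta>'..}" by (rule compact_positive_lower_bound[OF K(1,2)])
  \<comment> \<open>Taking the minimum with \<open>s / 2\<close> guarantees
    \<open>\<delta> < s\<close>, even when the support of \<psi> lies beyond
    \<open>s\<close>.\<close>
  define \<delta> where "\<delta> = min \<delta>' (s / 2)"
  have \<delta>: "0 < \<delta>" "\<delta> < s" using \<delta>' s by (auto simp: \<delta>_def)
  have zero: "\<psi> t = 0" "deriv \<psi> t = 0" if "t < \<delta>" for t
    using K(3,4)[of t] subsetD[OF \<delta>'(2), of t] that by (auto simp: \<delta>_def)
  note \<psi>c = continuous_on_subset[OF \<psi>(2) subset_UNIV] continuous_on_subset[OF \<psi>(3) subset_UNIV]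
  let ?J = "{\<delta>..s}"
  have J: "?J \<subseteq> {0<..<T}" "compact ?J" using \<delta> s by auto
  have \<phi>J: "continuous_on ?J \<phi>" using \<phi> J by (blast intro: continuous_on_subset)
  have gJ: "set_integrable lborel ?J g"
    using weak J unfolding has_weak_deriv_on_def locally_integrable_on_def by blast
  define \<omega> where "\<omega> k t = smooth_step ((s - t) * real k)" for k t
  define \<kappa> where "\<kappa> k t = real k * smooth_step_deriv ((s - t) * real k)" for k t
  have \<omega>\<kappa>: "continuous_on A (\<omega> k)" "continuous_on A (\<kappa> k)" for A k
    unfolding \<omega>_def \<kappa>_def by (intro continuous_intros)+
  have D: "((\<lambda>t. \<psi> t * \<omega> k t) has_real_derivative deriv \<psi> t * \<omega> k t - \<psi> t * \<kappa> k t) (at t)" for k t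
    unfolding \<omega>_def \<kappa>_def
    by (auto intro!: derivative_eq_intros \<psi>(1) DERIV_chain2[OF DERIV_smooth_step])
  have \<omega>_zero: "\<omega> k t = 0" "\<kappa> k t = 0" if "s < t" for k t
    using that unfolding \<omega>_def \<kappa>_def
    by (auto simp: mult_nonpos_nonneg intro!: smooth_step_le_0 smooth_step_deriv_le_0)
  \<comment> \<open>Before \<delta> the test function vanishes, after \<open>s\<close> the cutoff
    does. The product thus lives on a compact interval where \<phi> is continuous and
    \<open>g\<close> is integrable.\<close>
  have off: "\<psi> t = 0 \<and> deriv \<psi> t = 0 \<or> \<omega> k t = 0 \<and> \<kappa> k t = 0" if "t \<notin> ?J" for k t
    using that zero \<omega>_zero by (cases "t < \<delta>") auto
  have eq: "(LINT t:?J|lborel. \<omega> k t *\<^sub>R deriv \<psi> t *\<^sub>R \<phi> t)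
      - (LINT t:?J|lborel. \<kappa> k t *\<^sub>R \<psi> t *\<^sub>R \<phi> t) = - (LINT t:?J|lborel. \<omega> k t *\<^sub>R \<psi> t *\<^sub>R g t)" for k
  proof -
    have "test_function_on {0<..<T} (\<lambda>t. \<psi> t * \<omega> k t)"
    proof (rule test_function_onI[OF J(2,1) _ D])
      show "\<psi> t * \<omega> k t = 0" if "t \<notin> ?J" for t using off[OF that] by auto
      show "continuous_on UNIV (\<lambda>t. deriv \<psi> t * \<omega> k t - \<psi> t * \<kappa> k t)"
        by (intro continuous_intros \<omega>\<kappa> \<psi>)
    qed
    then have "(LINT t:{0<..<T}|lborel. (deriv \<psi> t * \<omega> k t - \<psi> t * \<kappa> k t) *\<^sub>R \<phi> t) =
        - (LINT t:{0<..<T}|lborel. (\<psi> t * \<omega> k t) *\<^sub>R g t)"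
      using weak unfolding has_weak_deriv_on_def DERIV_imp_deriv[OF D, symmetric] by blast
    also have "(LINT t:{0<..<T}|lborel. (deriv \<psi> t * \<omega> k t - \<psi> t * \<kappa> k t) *\<^sub>R \<phi> t)
        = (LINT t:?J|lborel. (deriv \<psi> t * \<omega> k t - \<psi> t * \<kappa> k t) *\<^sub>R \<phi> t)"
      by (rule LINT_support_eq[OF J(1)]) (use off in fastforce)
    also have "\<dots> = (LINT t:?J|lborel. \<omega> k t *\<^sub>R deriv \<psi> t *\<^sub>R \<phi> t - \<kappa> k t *\<^sub>R \<psi> t *\<^sub>R \<phi> t)"
      by (simp add: scaleR_diff_left mult.commute)
    also have "\<dots> = (LINT t:?J|lborel. \<omega> k t *\<^sub>R deriv \<psi> t *\<^sub>R \<phi> t)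
      - (LINT t:?J|lborel. \<kappa> k t *\<^sub>R \<psi> t *\<^sub>R \<phi> t)"
      by (intro set_integral_diff set_integrable_compact_continuous continuous_intros
          \<omega>\<kappa> \<psi>c \<phi>J J(2))
    also have "(LINT t:{0<..<T}|lborel. (\<psi> t * \<omega> k t) *\<^sub>R g t)
        = (LINT t:?J|lborel. (\<psi> t * \<omega> k t) *\<^sub>R g t)"
      by (rule LINT_support_eq[OF J(1)]) (use off in fastforce)
    finally show ?thesis by (simp add: mult.commute)
  qed
  have "(\<lambda>k. (LINT t:?J|lborel. \<omega> k t *\<^sub>R deriv \<psi> t *\<^sub>R \<phi> t)
      - (LINT t:?J|lborel. \<kappa> k t *\<^sub>R \<psi> t *\<^sub>R \<phi> t))
      \<longlonglongrightarrow> (LINT t:?J|lborel. deriv \<psi> t *\<^sub>R \<phi> t) - \<psi> s *\<^sub>R \<phi> s"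
    unfolding \<omega>_def \<kappa>_def using \<delta>
    by (intro tendsto_diff LINT_smooth_step_tendsto LINT_smooth_step_deriv_tendsto
        set_integrable_compact_continuous continuous_intros \<psi>c \<phi>J J(2)) auto
  moreover have "(\<lambda>k. - (LINT t:?J|lborel. \<omega> k t *\<^sub>R \<psi> t *\<^sub>R g t))
      \<longlonglongrightarrow> - (LINT t:?J|lborel. \<psi> t *\<^sub>R g t)"
    unfolding \<omega>_def
    by (intro tendsto_minus LINT_smooth_step_tendsto set_integrable_continuous_scaleR J(2) gJ \<psi>c)
  ultimately have "(LINT t:?J|lborel. deriv \<psi> t *\<^sub>R \<phi> t) - \<psi> s *\<^sub>R \<phi> s =
      - (LINT t:?J|lborel. \<psi> t *\<^sub>R g t)"
    unfolding eq by (rule LIMSEQ_unique)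
  moreover have "(LINT t:{0<..s}|lborel. deriv \<psi> t *\<^sub>R \<phi> t) = (LINT t:?J|lborel. deriv \<psi> t *\<^sub>R \<phi> t)"
    "(LINT t:{0<..s}|lborel. \<psi> t *\<^sub>R g t) = (LINT t:?J|lborel. \<psi> t *\<^sub>R g t)"
    by (rule LINT_support_eq; use \<delta> in \<open>auto simp: zero\<close>)+
  ultimately show ?thesis by (simp add: algebra_simps)
qed

text \<open>Tested with a function equal to \<open>1\<close> on \<open>[a, b]\<close>, the boundary terms at \<open>a\<close> and \<open>b\<close> give
  the fundamental theorem of calculus.\<close>

lemma weak_deriv_FTC:
  fixes \<phi> g :: "real \<Rightarrow> real ^ 'n"
  assumes weak: "has_weak_deriv_on \<phi> g {0<..<T}" and \<phi>: "continuous_on {0<..<T} \<phi>"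
    and ab: "0 < a" "a \<le> b" "b < T"
  shows "\<phi> b - \<phi> a = (LINT t:{a<..b}|lborel. g t)"
proof -
  \<comment> \<open>The first factor rises on [a/2, a], the second falls on [b, b + 1]. The support
    may extend past \<open>T\<close>: \<open>weak_deriv_by_parts\<close> asks for a support in the
    positive half-line.\<close>
  define \<psi> where "\<psi> t = smooth_step (2 * t / a - 1) * smooth_step (b + 1 - t)" for t
  define D where "D t = smooth_step_deriv (2 * t / a - 1) * (2 / a) * smooth_step (b + 1 - t)
    - smooth_step (2 * t / a - 1) * smooth_step_deriv (b + 1 - t)" for t
  have D: "(\<psi> has_real_derivative D t) (at t)" for t
    unfolding \<psi>_def D_def using ab
    by (auto intro!: derivative_eq_intros DERIV_chain2[OF DERIV_smooth_step])
  then have deriv: "deriv \<psi> t = D t" for t by (rule DERIV_imp_deriv)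
  have "continuous_on UNIV (\<lambda>t. D t)"
    unfolding D_def using ab by (intro continuous_intros) auto
  then have D_cont: "continuous_on A D" for A by (rule continuous_on_subset) simp
  have one: "\<psi> t = 1" "D t = 0" if "t \<in> {a..b}" for t
    using that ab by (simp_all add: \<psi>_def D_def smooth_step_ge_1 smooth_step_deriv_ge_1 field_simps)
  have zero: "\<psi> t = 0" "D t = 0" if "t < a / 2" for t
    using that ab by (simp_all add: \<psi>_def D_def smooth_step_le_0 smooth_step_deriv_le_0 field_simps)
  have test: "test_function_on {0<..} \<psi>"
    by (rule test_function_onI[of "{a/2..b+1}", OF _ _ _ D D_cont])
      (use ab in \<open>auto simp: \<psi>_def smooth_step_le_0 field_simps\<close>)
  have \<psi>_cont: "continuous_on A \<psi>" for A
    using D DERIV_isCont continuous_at_imp_continuous_on by blast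
  have J: "compact {a/2..b}" "{a/2..b} \<subseteq> {0<..<T}" using ab by auto
  have g: "set_integrable lborel {a/2..b} (\<lambda>t. \<psi> t *\<^sub>R g t)"
    using weak J unfolding has_weak_deriv_on_def locally_integrable_on_def
    by (intro set_integrable_continuous_scaleR \<psi>_cont) auto
  have g': "set_integrable lborel S (\<lambda>t. \<psi> t *\<^sub>R g t)" if "S \<in> sets lborel" "S \<subseteq> {0<..b}" for S
  proof -
    have "set_integrable lborel (S \<inter> {a/2..b}) (\<lambda>t. \<psi> t *\<^sub>R g t)"
      by (rule set_integrable_subset[OF g]) (use that in auto)
    then show ?thesis by (rule set_integrable_support) (use that zero(1) in force)+
  qed
  have "(LINT t:{0<..b}|lborel. \<psi> t *\<^sub>R g t)
      = (LINT t:{0<..a} \<union> {a<..b}|lborel. \<psi> t *\<^sub>R g t)"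
    using ab by (simp add: ivl_disj_un)
  also have "\<dots> = (LINT t:{0<..a}|lborel. \<psi> t *\<^sub>R g t) + (LINT t:{a<..b}|lborel. \<psi> t *\<^sub>R g t)"
    by (rule set_integral_Un) (use ab in \<open>auto intro!: g'\<close>)
  also have "(LINT t:{a<..b}|lborel. \<psi> t *\<^sub>R g t) = (LINT t:{a<..b}|lborel. g t)"
    by (rule set_lebesgue_integral_cong) (auto simp: one)
  finally have g_eq: "(LINT t:{a<..b}|lborel. g t) =
      (LINT t:{0<..b}|lborel. \<psi> t *\<^sub>R g t) - (LINT t:{0<..a}|lborel. \<psi> t *\<^sub>R g t)" by simp
  \<comment> \<open>\<psi> is constant on [a, b], so integrating by parts up to \<open>a\<close> and
    up to \<open>b\<close> gives the same left-hand side; equating the right-hand sides leaves the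
    increment of \<phi>.\<close>
  have "(LINT t:{0<..b}|lborel. deriv \<psi> t *\<^sub>R \<phi> t) = (LINT t:{0<..a}|lborel. deriv \<psi> t *\<^sub>R \<phi> t)"
    by (rule LINT_support_eq) (use ab one(2) deriv in auto)
  with weak_deriv_by_parts[OF weak \<phi> test, of a] weak_deriv_by_parts[OF weak \<phi> test, of b]
  have "\<phi> b - (LINT t:{0<..b}|lborel. \<psi> t *\<^sub>R g t) = \<phi> a - (LINT t:{0<..a}|lborel. \<psi> t *\<^sub>R g t)"
    using ab by (simp add: one)
  then show ?thesis unfolding g_eq by (simp add: algebra_simps)
qed

text \<open>Half-open intervals form an intersection-stable generator of the Borel sets, so
  vanishing of the integral passes to all Borel sets by Dynkin's argument; an integrable function
  with this property is 0 almost everywhere.\<close>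

lemma AE_zero_if_interval_integrals_zero:
  fixes f :: "real \<Rightarrow> 'b::{banach, second_countable_topology}"
  assumes f: "set_integrable lborel {a<..b} f"
    and zero: "\<And>c d. a \<le> c \<Longrightarrow> c \<le> d \<Longrightarrow> d \<le> b \<Longrightarrow> (LINT t:{c<..d}|lborel. f t) = 0"
  shows "AE t in lborel. t \<in> {a<..b} \<longrightarrow> f t = 0"
proof -
  define h where "h t = indicator {a<..b} t *\<^sub>R f t" for t
  have h: "integrable lborel h" using f by (simp add: h_def[abs_def] set_integrable_def)
  then have hA: "set_integrable lborel A h" if "A \<in> sets borel" for A
    using that by (auto simp: set_integrable_def intro: integrable_mult_indicator)
  let ?G = "range (\<lambda>(c, d). {c<..d :: real})"
  have Ioc: "(LINT t:{c<..d}|lborel. h t) = 0" for c d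
  proof -
    have "(LINT t:{c<..d}|lborel. h t) = (LINT t:{max a c<..min b d}|lborel. f t)"
      unfolding set_lebesgue_integral_def h_def
      by (rule Bochner_Integration.integral_cong) (auto split: split_indicator)
    also have "\<dots> = 0"
      using zero[of "max a c" "min b d"]
      by (cases "max a c \<le> min b d") (auto simp: set_lebesgue_integral_def)
    finally show ?thesis .
  qed
  have gen: "sets (borel :: real measure) = sigma_sets UNIV ?G"
    by (subst borel_sigma_sets_Ioc) simp
  \<comment> \<open>The complement step of the induction needs the integral over the whole line; as
    \<open>h\<close> vanishes off one interval, it is an interval integral too.\<close>
  have total: "(LINT t|lborel. h t) = 0"
    using Ioc[of a b] unfolding set_lebesgue_integral_def h_def by (simp add: indicator_inter_arith[symmetric])
  have "(LINT t:A|lborel. h t) = 0" if "A \<in> sets lborel" for A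
  proof -
    have "A \<in> sigma_sets UNIV ?G" using that gen by simp
    then show ?thesis
    proof (induction rule: sigma_sets_induct_disjoint[rotated 2, consumes 1, case_names basic empty compl union int pow])
      case (basic A)
      then show ?case using Ioc by auto
    next
      case empty
      then show ?case by (simp add: set_lebesgue_integral_def)
    next
      case (compl A)
      then have A: "A \<in> sets borel" using gen by simp
      have "(LINT t:A \<union> (UNIV - A)|lborel. h t) = (LINT t:A|lborel. h t) + (LINT t:UNIV - A|lborel. h t)"
        using A by (intro set_integral_Un hA) auto
      then show ?case using compl total by (simp add: set_lebesgue_integral_def)
    next
      case (union A)
      then have A: "A i \<in> sets lborel" for i using gen by auto
      have "(LINT t:(\<Union>i. A i)|lborel. h t) = (\<Sum>i. (LINT t:(A i)|lborel. h t))"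
        using A union(1) by (intro lebesgue_integral_countable_add hA)
          (auto simp: disjoint_family_on_def)
      then show ?case using union by simp
    next
      case int
      show ?case by (auto simp: Int_stable_def)
    next
      case pow
      show ?case by simp
    qed
  qed
  then have "AE t in lborel. h t = 0" using h by (intro sigma_finite_measure.density_zero[OF lborel.sigma_finite_measure_axioms]) auto
  then show ?thesis by eventually_elim (auto simp: h_def)
qed

section \<open>Uniqueness and existence of the velocity\<close>

lemma has_weak_deriv_on_subset:
  assumes "has_weak_deriv_on \<phi> g S" "S' \<subseteq> S"
  shows "has_weak_deriv_on \<phi> g S'"
  unfolding has_weak_deriv_on_def
proof (intro conjI allI impI)
  show "locally_integrable_on S' \<phi>" "locally_integrable_on S' g"
    using assms unfolding has_weak_deriv_on_def locally_integrable_on_def by (meson order_trans)+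
  fix \<psi> assume test: "test_function_on S' \<psi>"
  obtain K where K: "K \<subseteq> S'" "\<And>t. t \<notin> K \<Longrightarrow> \<psi> t = 0" "\<And>t. t \<notin> K \<Longrightarrow> deriv \<psi> t = 0"
    by (rule test_function_onE[OF test]) blast
  have "test_function_on S \<psi>"
    using test assms(2) unfolding test_function_on_def by (meson order_trans)
  then have "(LINT t:S|lborel. deriv \<psi> t *\<^sub>R \<phi> t) = - (LINT t:S|lborel. \<psi> t *\<^sub>R g t)"
    using assms(1) by (auto simp: has_weak_deriv_on_def)
  moreover have "(LINT t:S|lborel. deriv \<psi> t *\<^sub>R \<phi> t) = (LINT t:S'|lborel. deriv \<psi> t *\<^sub>R \<phi> t)"
    "(LINT t:S|lborel. \<psi> t *\<^sub>R g t) = (LINT t:S'|lborel. \<psi> t *\<^sub>R g t)"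
    using assms(2) K by (intro LINT_support_eq; force)+
  ultimately show "(LINT t:S'|lborel. deriv \<psi> t *\<^sub>R \<phi> t) = - (LINT t:S'|lborel. \<psi> t *\<^sub>R g t)"
    by simp
qed

lemma has_torus_weak_deriv_on_subset:
  "has_torus_weak_deriv_on \<Phi> g S \<Longrightarrow> S' \<subseteq> S \<Longrightarrow> has_torus_weak_deriv_on \<Phi> g S'"
  unfolding has_torus_weak_deriv_on_def
  by (meson continuous_on_subset has_weak_deriv_on_subset subsetD)

text \<open>Needed for a velocity glued from pieces, which agrees with a given weak derivative only
  almost everywhere.\<close>

lemma has_weak_deriv_on_cong_AE:
  assumes weak: "has_weak_deriv_on \<phi> g S" and g': "locally_integrable_on S g'"
    and ae: "AE t in lborel. t \<in> S \<longrightarrow> g t = g' t"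
  shows "has_weak_deriv_on \<phi> g' S"
  unfolding has_weak_deriv_on_def
proof (intro conjI allI impI)
  show "locally_integrable_on S \<phi>" "locally_integrable_on S g'"
    using weak g' by (auto simp: has_weak_deriv_on_def)
  fix \<psi> assume test: "test_function_on S \<psi>"
  obtain K where K: "compact K" "K \<subseteq> S" "\<And>t. t \<notin> K \<Longrightarrow> \<psi> t = 0" and \<psi>: "continuous_on UNIV \<psi>"
    by (rule test_function_onE[OF test]) blast
  have "set_integrable lborel K (\<lambda>t. \<psi> t *\<^sub>R g t)" "set_integrable lborel K (\<lambda>t. \<psi> t *\<^sub>R g' t)"
    using weak g' K \<psi> unfolding has_weak_deriv_on_def locally_integrable_on_def
    by (auto intro!: set_integrable_continuous_scaleR continuous_on_subset[OF \<psi>])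
  moreover have "AE t in lborel. indicator K t *\<^sub>R \<psi> t *\<^sub>R g t = indicator K t *\<^sub>R \<psi> t *\<^sub>R g' t"
    using ae by eventually_elim (use K in \<open>auto split: split_indicator\<close>)
  ultimately have "(LINT t:K|lborel. \<psi> t *\<^sub>R g t) = (LINT t:K|lborel. \<psi> t *\<^sub>R g' t)"
    unfolding set_lebesgue_integral_def set_integrable_def
    by (intro integral_cong_AE borel_measurable_integrable)
  moreover have "(LINT t:S|lborel. \<psi> t *\<^sub>R g t) = (LINT t:K|lborel. \<psi> t *\<^sub>R g t)"
    "(LINT t:S|lborel. \<psi> t *\<^sub>R g' t) = (LINT t:K|lborel. \<psi> t *\<^sub>R g' t)"
    using K by (intro LINT_support_eq; force)+
  ultimately show "(LINT t:S|lborel. deriv \<psi> t *\<^sub>R \<phi> t) = - (LINT t:S|lborel. \<psi> t *\<^sub>R g' t)"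
    using weak test by (simp add: has_weak_deriv_on_def)
qed

text \<open>Each coordinate of the difference is continuous with values in the integer multiples of
  2 pi. Distinct values are at least 2 pi apart, so connectedness makes it constant.\<close>

lemma torus_lift_diff_constant:
  fixes \<phi> \<phi>' :: "real \<Rightarrow> real ^ 'n::finite"
  assumes S: "connected S" and \<phi>: "continuous_on S \<phi>" "continuous_on S \<phi>'"
    and eq: "\<And>t. t \<in> S \<Longrightarrow> to_torus (\<phi> t) = to_torus (\<phi>' t)"
    and ab: "a \<in> S" "b \<in> S"
  shows "\<phi> b - \<phi> a = \<phi>' b - \<phi>' a"
proof -
  have "\<phi> b $ i - \<phi>' b $ i = \<phi> a $ i - \<phi>' a $ i" for i
  proof -
    have "(\<lambda>t. \<phi> t $ i - \<phi>' t $ i) constant_on S"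
    proof (rule continuous_discrete_range_constant[OF S])
      show "continuous_on S (\<lambda>t. \<phi> t $ i - \<phi>' t $ i)" by (intro continuous_intros \<phi>)
      fix x assume "x \<in> S"
      then obtain k :: int where k: "\<phi> x $ i - \<phi>' x $ i = 2 * pi * of_int k"
        using eq to_torus_eq_iff unfolding torus_rel_def by metis
      show "\<exists>e>0. \<forall>y. y \<in> S \<and> \<phi> y $ i - \<phi>' y $ i \<noteq> \<phi> x $ i - \<phi>' x $ i \<longrightarrow>
          e \<le> norm (\<phi> y $ i - \<phi>' y $ i - (\<phi> x $ i - \<phi>' x $ i))"
      proof (intro exI[of _ "2 * pi"] conjI allI impI; (elim conjE)?)
        fix y assume "y \<in> S" and ne: "\<phi> y $ i - \<phi>' y $ i \<noteq> \<phi> x $ i - \<phi>' x $ i"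
        then obtain l :: int where l: "\<phi> y $ i - \<phi>' y $ i = 2 * pi * of_int l"
          using eq to_torus_eq_iff unfolding torus_rel_def by metis
        with k ne have "l \<noteq> k" by auto
        then have "\<bar>of_int (l - k) :: real\<bar> \<ge> 1" by linarith
        then have "2 * pi * 1 \<le> 2 * pi * \<bar>of_int (l - k)\<bar>" by (intro mult_left_mono) auto
        then show "2 * pi \<le> norm (\<phi> y $ i - \<phi>' y $ i - (\<phi> x $ i - \<phi>' x $ i))"
          by (simp add: k l abs_mult right_diff_distrib[symmetric])
      qed simp
    qed
    then show ?thesis using ab unfolding constant_on_def by metis
  qed
  then show ?thesis by (simp add: vec_eq_iff algebra_simps)
qed

text \<open>Lifts of the same curve have the same increments, so by the fundamental theorem of
  calculus \<open>g\<close> and \<open>g'\<close> have the same integral over every interval inside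
  (0, T).\<close>

lemma torus_weak_deriv_unique:
  assumes 1: "has_torus_weak_deriv_on \<Phi> g {0<..<T}" and 2: "has_torus_weak_deriv_on \<Phi> g' {0<..<T}"
  shows "AE t in lborel. t \<in> {0<..<T} \<longrightarrow> g t = g' t"
proof (cases "T > 0")
  case True
  obtain \<phi> where \<phi>: "continuous_on {0<..<T} \<phi>" "\<And>t. t \<in> {0<..<T} \<Longrightarrow> to_torus (\<phi> t) = \<Phi> t"
    "has_weak_deriv_on \<phi> g {0<..<T}"
    using 1 unfolding has_torus_weak_deriv_on_def by blast
  obtain \<phi>' where \<phi>': "continuous_on {0<..<T} \<phi>'" "\<And>t. t \<in> {0<..<T} \<Longrightarrow> to_torus (\<phi>' t) = \<Phi> t"
    "has_weak_deriv_on \<phi>' g' {0<..<T}"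
    using 2 unfolding has_torus_weak_deriv_on_def by blast
  \<comment> \<open>Local integrability says nothing up to the ends of (0, T), so the comparison
    runs on intervals that stay away from both ends and exhaust (0, T).\<close>
  define a b where "a k = T / (real k + 2)" and "b k = T - T / (real k + 2)" for k :: nat
  have "AE t in lborel. t \<in> {a k<..b k} \<longrightarrow> g t - g' t = 0" for k
  proof (rule AE_zero_if_interval_integrals_zero)
    have ab: "0 < a k" "b k < T" using True by (auto simp: a_def b_def)
    have int: "set_integrable lborel {c<..d} g" "set_integrable lborel {c<..d} g'"
      if "a k \<le> c" "d \<le> b k" for c d
    proof -
      have "compact {c..d}" "{c..d} \<subseteq> {0<..<T}" using that ab by auto
      then have "set_integrable lborel {c..d} g" "set_integrable lborel {c..d} g'"
        using \<phi>(3) \<phi>'(3) unfolding has_weak_deriv_on_def locally_integrable_on_def by blast+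
      then show "set_integrable lborel {c<..d} g" "set_integrable lborel {c<..d} g'"
        by (auto elim!: set_integrable_subset)
    qed
    then show "set_integrable lborel {a k<..b k} (\<lambda>t. g t - g' t)" by simp
    fix c d assume cd: "a k \<le> c" "c \<le> d" "d \<le> b k"
    have "\<phi> d - \<phi> c = \<phi>' d - \<phi>' c"
      using torus_lift_diff_constant[of "{0<..<T}" \<phi> \<phi>' c d] \<phi> \<phi>' cd ab by auto
    then have "(LINT t:{c<..d}|lborel. g t) = (LINT t:{c<..d}|lborel. g' t)"
      using weak_deriv_FTC[OF \<phi>(3,1), of c d] weak_deriv_FTC[OF \<phi>'(3,1), of c d] cd ab by auto
    then show "(LINT t:{c<..d}|lborel. g t - g' t) = 0"
      using int[of c d] cd by simp
  qed
  then have "AE t in lborel. \<forall>k. t \<in> {a k<..b k} \<longrightarrow> g t - g' t = 0"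
    unfolding AE_all_countable by blast
  then show ?thesis
  proof eventually_elim
    case (elim t)
    show ?case
    proof
      assume t: "t \<in> {0<..<T}"
      \<comment> \<open>Makes \<open>T / (real k + 2)\<close> smaller than the distance from
        \<open>t\<close> to either end.\<close>
      obtain k where k: "real k > T / min t (T - t)" using reals_Archimedean2 by blast
      have pos: "min t (T - t) > 0" using t by auto
      then have "T < real k * min t (T - t)" using k by (simp add: pos_divide_less_eq)
      also have "\<dots> < (real k + 2) * min t (T - t)" using pos by (intro mult_strict_right_mono) auto
      finally have "T < (real k + 2) * min t (T - t)" .
      then have "T / (real k + 2) < min t (T - t)"
        by (subst pos_divide_less_eq) (auto simp only: mult.commute)
      then have "t \<in> {a k<..b k}" by (auto simp: a_def b_def)
      with elim show "g t = g' t" by auto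
    qed
  qed
qed auto

text \<open>\<open>torus_H1_loc\<close> yields a weak derivative for each \<open>T\<close>
  separately, whereas the choice in \<open>velocity\<close> needs a single \<open>g\<close> for all
  \<open>T\<close>. Gluing pieces of these derivatives gives one, because any two agree almost
  everywhere on the shorter interval.\<close>

lemma velocity_has_torus_weak_deriv:
  fixes \<Phi> :: "real \<Rightarrow> 'n::finite torus"
  assumes "torus_H1_loc \<Phi>" "T > 0"
  shows "has_torus_weak_deriv_on \<Phi> (velocity \<Phi>) {0<..<T}"
proof -
  have "\<exists>g. has_torus_weak_deriv_on \<Phi> g {0<..<T}" if "T > 0" for T
    using assms(1) that unfolding torus_H1_loc_def torus_H1_def by blast
  then have "\<forall>m :: nat. \<exists>g. has_torus_weak_deriv_on \<Phi> g {0<..<real m + 1}"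
    by (auto intro: less_le_trans[of 0 1])
  then obtain G where G: "\<And>m :: nat. has_torus_weak_deriv_on \<Phi> (G m) {0<..<real m + 1}" by metis
  \<comment> \<open>On (m - 1, m] this is \<open>G m\<close>. Its interval (0, m + 1) extends past
    \<open>m\<close>, so that a compact set of positive times up to \<open>m\<close> lies inside
    it.\<close>
  define g where "g t = G (nat \<lceil>t\<rceil>) t" for t
  have g_eq: "g t = G m t" if "t \<in> {real m - 1<..real m}" for t m
  proof -
    have "\<lceil>t\<rceil> = int m" using that by (intro ceiling_unique) auto
    then show ?thesis by (simp add: g_def)
  qed
  have "has_torus_weak_deriv_on \<Phi> g {0<..<T}" if "T > 0" for T
  proof -
    have "has_torus_weak_deriv_on \<Phi> (G (nat \<lceil>T\<rceil>)) {0<..<T}"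
      by (rule has_torus_weak_deriv_on_subset[OF G]) (auto intro: less_le_trans; linarith)
    then obtain \<phi> where \<phi>: "continuous_on {0<..<T} \<phi>" "\<forall>t\<in>{0<..<T}. to_torus (\<phi> t) = \<Phi> t"
      "has_weak_deriv_on \<phi> (G (nat \<lceil>T\<rceil>)) {0<..<T}" unfolding has_torus_weak_deriv_on_def by blast
    have loc: "locally_integrable_on {0<..<T} g"
      unfolding locally_integrable_on_def
    proof (intro allI impI, elim conjE)
      fix K assume K: "compact K" "K \<subseteq> {0<..<T}"
      then have [measurable]: "K \<in> sets borel" by (simp add: borel_compact)
      \<comment> \<open>Only the pieces with \<open>m\<close> up to
        \<open>nat \<lceil>T\<rceil>\<close> meet \<open>K\<close>, so a finite union
        suffices.\<close>
      have "set_integrable lborel (\<Union>m\<in>{..nat \<lceil>T\<rceil>}. K \<inter> {real m - 1<..real m}) g"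
      proof (rule set_integrable_UN)
        fix m assume "m \<in> {..nat \<lceil>T\<rceil>}"
        have "compact (K \<inter> {real m - 1..real m})" "K \<inter> {real m - 1..real m} \<subseteq> {0<..<real m + 1}"
          using K by (auto intro: compact_Int)
        then have "set_integrable lborel (K \<inter> {real m - 1..real m}) (G m)"
          using G[of m] unfolding has_torus_weak_deriv_on_def has_weak_deriv_on_def
            locally_integrable_on_def by blast
        then have "set_integrable lborel (K \<inter> {real m - 1<..real m}) (G m)"
          by (rule set_integrable_subset) (use K in auto)
        then show "set_integrable lborel (K \<inter> {real m - 1<..real m}) g"
          by (rule set_integrable_cong[THEN iffD1, rotated 3]) (auto simp: g_eq)
      qed (use K in auto)
      also have "(\<Union>m\<in>{..nat \<lceil>T\<rceil>}. K \<inter> {real m - 1<..real m}) = K"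
      proof (intro equalityI subsetI)
        fix t assume "t \<in> K"
        with K have "t \<in> {0<..<T}" by blast
        then have "nat \<lceil>t\<rceil> \<le> nat \<lceil>T\<rceil>" "t \<in> {real (nat \<lceil>t\<rceil>) - 1<..real (nat \<lceil>t\<rceil>)}"
          by (auto intro!: nat_mono ceiling_mono; linarith)+
        with \<open>t \<in> K\<close> show "t \<in> (\<Union>m\<in>{..nat \<lceil>T\<rceil>}. K \<inter> {real m - 1<..real m})" by blast
      qed auto
      finally show "set_integrable lborel K g" .
    qed
    have "AE t in lborel. t \<in> {0<..<min T (real m + 1)} \<longrightarrow> G (nat \<lceil>T\<rceil>) t = G m t" for m
    proof (rule torus_weak_deriv_unique)
      show "has_torus_weak_deriv_on \<Phi> (G (nat \<lceil>T\<rceil>)) {0<..<min T (real m + 1)}"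
        by (rule has_torus_weak_deriv_on_subset[OF G]) (auto intro: less_le_trans; linarith)
      show "has_torus_weak_deriv_on \<Phi> (G m) {0<..<min T (real m + 1)}"
        by (rule has_torus_weak_deriv_on_subset[OF G]) auto
    qed
    then have "AE t in lborel. \<forall>m. t \<in> {0<..<min T (real m + 1)} \<longrightarrow> G (nat \<lceil>T\<rceil>) t = G m t"
      unfolding AE_all_countable by blast
    then have "AE t in lborel. t \<in> {0<..<T} \<longrightarrow> G (nat \<lceil>T\<rceil>) t = g t"
    proof eventually_elim
      case (elim t)
      have "t < real (nat \<lceil>t\<rceil>) + 1" by linarith
      with elim show ?case unfolding g_def by auto
    qed
    from has_weak_deriv_on_cong_AE[OF \<phi>(3) loc this] \<phi>(1,2)
    show ?thesis unfolding has_torus_weak_deriv_on_def by blast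
  qed
  then have "\<exists>g. \<forall>T>0. has_torus_weak_deriv_on \<Phi> g {0<..<T}" by blast
  then have "\<forall>T>0. has_torus_weak_deriv_on \<Phi> (velocity \<Phi>) {0<..<T}"
    unfolding velocity_def by (rule someI_ex)
  with assms(2) show ?thesis by blast
qed

text \<open>This makes the action of an explicit curve computable: under the integral, the chosen
  velocity may be replaced by any known weak derivative.\<close>

lemma velocity_AE_unique:
  assumes "torus_H1_loc \<Phi>" "\<And>T. T > 0 \<Longrightarrow> has_torus_weak_deriv_on \<Phi> g {0<..<T}"
  shows "AE t in lborel. t > 0 \<longrightarrow> velocity \<Phi> t = g t"
proof -
  have "AE t in lborel. t \<in> {0<..<real m + 1} \<longrightarrow> velocity \<Phi> t = g t" for m
    by (intro torus_weak_deriv_unique[of \<Phi>] velocity_has_torus_weak_deriv assms)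
      (auto intro: add_nonneg_pos)
  then have "AE t in lborel. \<forall>m. t \<in> {0<..<real m + 1} \<longrightarrow> velocity \<Phi> t = g t"
    unfolding AE_all_countable by blast
  then show ?thesis
  proof eventually_elim
    case (elim t)
    obtain m where "t < real m" using reals_Archimedean2 by blast
    with elim[rule_format, of m] show ?case by auto
  qed
qed

section \<open>Appending a segment to a curve\<close>

definition unit_time_segment :: "real ^ 'n \<Rightarrow> real ^ 'n \<Rightarrow> real \<Rightarrow> real \<Rightarrow> real ^ 'n" where
  "unit_time_segment v w s t = v + min (t - s) 1 *\<^sub>R (w - v)"

definition segment_velocity :: "real ^ 'n \<Rightarrow> real ^ 'n \<Rightarrow> real \<Rightarrow> real \<Rightarrow> real ^ 'n" where
  "segment_velocity v w s t = indicator {s<..s + 1} t *\<^sub>R (w - v)"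

lemma continuous_on_unit_time_segment: "continuous_on A (unit_time_segment v w s)"
  unfolding unit_time_segment_def by (intro continuous_intros)

lemma unit_time_segment_start [simp]: "unit_time_segment v w s s = v"
  by (simp add: unit_time_segment_def)

lemma unit_time_segment_has_vector_derivative:
  assumes "s < t" "t \<noteq> s + 1"
  shows "(unit_time_segment v w s has_vector_derivative segment_velocity v w s t) (at t)"
proof (cases "t < s + 1")
  case True
  have "((\<lambda>t. v + (t - s) *\<^sub>R (w - v)) has_vector_derivative (w - v)) (at t)"
    by (auto intro!: derivative_eq_intros)
  then have "(unit_time_segment v w s has_vector_derivative (w - v)) (at t)"
    by (rule has_vector_derivative_transform_within_open[of _ _ _ "{s<..<s + 1}"])
      (use assms True in \<open>auto simp: unit_time_segment_def\<close>)
  with True assms show ?thesis by (simp add: segment_velocity_def)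
next
  case False
  have "((\<lambda>t. w) has_vector_derivative 0) (at t)" by simp
  then have "(unit_time_segment v w s has_vector_derivative 0) (at t)"
    by (rule has_vector_derivative_transform_within_open[of _ _ _ "{s + 1<..}"])
      (use assms False in \<open>auto simp: unit_time_segment_def\<close>)
  with False assms show ?thesis by (simp add: segment_velocity_def)
qed

lemma integrable_segment_velocity: "integrable lborel (segment_velocity v w s)"
  unfolding segment_velocity_def[abs_def]
  by (rule integrable_scaleR_left) (simp add: integrable_indicator_iff)

lemma LINT_Ioc_eq_Icc:
  fixes f :: "real \<Rightarrow> 'b::{banach, second_countable_topology}"
  shows "(LINT t:{a<..b}|lborel. f t) = (LINT t:{a..b}|lborel. f t)"
  by (rule set_integral_discrete_difference[of "{a}"]) auto

text \<open>At \<open>s\<close> the boundary terms of the two pieces cancel. The case \<open>s = 0\<close>, with no first piece,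
  is included.\<close>

lemma has_weak_deriv_on_append_segment:
  fixes \<phi> V :: "real \<Rightarrow> real ^ 'n" and v w :: "real ^ 'n"
  assumes s: "s \<ge> 0" and weak: "has_weak_deriv_on \<phi> V {0<..<s + 1}"
    and \<phi>: "continuous_on {0<..<s + 1} \<phi>"
  defines "\<eta> \<equiv> \<lambda>t. if t \<le> s then \<phi> t - \<phi> s + v else unit_time_segment v w s t"
    and "g \<equiv> \<lambda>t. if t \<le> s then V t else segment_velocity v w s t"
  shows "continuous_on {0<..} \<eta>" and "has_weak_deriv_on \<eta> g {0<..<T}"
proof -
  have "continuous_on ({0<..s} \<union> {s..}) \<eta>" if "s > 0"
    unfolding \<eta>_def
  proof (rule continuous_on_cases_local)
    show "closedin (top_of_set ({0<..s} \<union> {s..})) {0<..s}"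
      using that by (auto simp: closedin_closed intro!: exI[of _ "{..s}"])
    show "closedin (top_of_set ({0<..s} \<union> {s..})) {s..}"
      by (auto simp: closedin_closed intro!: exI[of _ "{s..}"])
    show "continuous_on {0<..s} (\<lambda>t. \<phi> t - \<phi> s + v)"
      by (intro continuous_intros continuous_on_subset[OF \<phi>]) auto
  qed (auto intro: continuous_on_unit_time_segment)
  moreover have "{0<..s} \<union> {s..} = {0<..}" if "s > 0" using that by auto
  \<comment> \<open>If \<open>s = 0\<close>, no positive time falls into the first branch and \<eta>
    is just the segment.\<close>
  moreover have "continuous_on {0<..} \<eta>" if "s = 0"
    by (rule continuous_on_cong[THEN iffD1, OF refl _ continuous_on_unit_time_segment[of _ v w s]])
      (use that in \<open>auto simp: \<eta>_def\<close>)
  ultimately show \<eta>: "continuous_on {0<..} \<eta>" using s by (cases "s = 0") auto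
  have V: "set_integrable lborel K V" if "compact K" "K \<subseteq> {0<..s}" for K
  proof -
    have "K \<subseteq> {0<..<s + 1}" using that by fastforce
    with weak that(1) show ?thesis unfolding has_weak_deriv_on_def locally_integrable_on_def by blast
  qed
  have g: "set_integrable lborel K g" if K: "compact K" "K \<subseteq> {0<..}" for K
  proof -
    have [measurable]: "K \<in> sets borel" using K by (simp add: borel_compact)
    have "set_integrable lborel (K \<inter> {..s}) V"
      using K by (intro V compact_Int_closed) auto
    then have "set_integrable lborel (K \<inter> {..s}) g"
      by (rule set_integrable_cong[THEN iffD1, rotated 3]) (auto simp: g_def)
    moreover have "set_integrable lborel (K \<inter> {s<..}) (segment_velocity v w s)"
      unfolding set_integrable_def by (intro integrable_mult_indicator integrable_segment_velocity) auto
    then have "set_integrable lborel (K \<inter> {s<..}) g"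
      by (rule set_integrable_cong[THEN iffD1, rotated 3]) (auto simp: g_def)
    ultimately have "set_integrable lborel (K \<inter> {..s} \<union> K \<inter> {s<..}) g"
      by (intro set_integrable_Un) auto
    also have "K \<inter> {..s} \<union> K \<inter> {s<..} = K" by auto
    finally show ?thesis .
  qed
  show "has_weak_deriv_on \<eta> g {0<..<T}"
    unfolding has_weak_deriv_on_def
  proof (intro conjI allI impI)
    show "locally_integrable_on {0<..<T} \<eta>" "locally_integrable_on {0<..<T} g"
      unfolding locally_integrable_on_def
    proof (safe, goal_cases)
      case (1 K)
      then have "K \<subseteq> {0<..}" by auto
      with 1(1) show ?case by (intro set_integrable_compact_continuous continuous_on_subset[OF \<eta>])
    next
      case (2 K)
      then have "K \<subseteq> {0<..}" by auto
      with 2(1) show ?case by (rule g)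
    qed
    fix \<psi> assume test: "test_function_on {0<..<T} \<psi>"
    obtain K where K: "compact K" "K \<subseteq> {0<..<T}" "\<And>t. t \<notin> K \<Longrightarrow> \<psi> t = 0" "\<And>t. t \<notin> K \<Longrightarrow> deriv \<psi> t = 0"
      and \<psi>: "\<And>t. (\<psi> has_real_derivative deriv \<psi> t) (at t)"
        "continuous_on UNIV \<psi>" "continuous_on UNIV (deriv \<psi>)"
      by (rule test_function_onE[OF test]) blast
    note \<psi>c = continuous_on_subset[OF \<psi>(2) subset_UNIV] continuous_on_subset[OF \<psi>(3) subset_UNIV]
    have test': "test_function_on {0<..} \<psi>"
      by (rule test_function_onI[OF K(1) _ K(3) \<psi>(1,3)]) (use K(2) in auto)
    have "0 \<notin> K" using K(2) by auto
    \<comment> \<open>Removes the boundary term at 0 and, if \<open>s = 0\<close>, the term at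
      \<open>s\<close> as well.\<close>
    then have \<psi>0: "\<psi> 0 = 0" "deriv \<psi> 0 = 0" using K by blast+
    \<comment> \<open>A common right end beyond both \<open>s\<close> and \<open>T\<close>:
      splitting at \<open>s\<close> is then valid even for \<open>T \<le> s\<close>, and \<psi>
      vanishes at \<open>R\<close>.\<close>
    define R where "R = \<bar>T\<bar> + s + 1"
    have R: "{0<..<T} \<subseteq> {0<..R}" "s < R" "T < R"
      using s by (auto simp: R_def)
    then have KR: "K \<subseteq> {0<..R}" and "R \<notin> K" using K(2) by auto
    then have \<psi>R: "\<psi> R = 0" using K(3) by blast
    have int: "set_integrable lborel {0<..R} (\<lambda>t. deriv \<psi> t *\<^sub>R \<eta> t)"
      "set_integrable lborel {0<..R} (\<lambda>t. \<psi> t *\<^sub>R g t)"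
    proof -
      have K': "K \<subseteq> {0<..}" using K(2) by auto
      have "set_integrable lborel K (\<lambda>t. deriv \<psi> t *\<^sub>R \<eta> t)"
        by (intro set_integrable_compact_continuous continuous_intros \<psi>c K(1)
            continuous_on_subset[OF \<eta> K'])
      then show "set_integrable lborel {0<..R} (\<lambda>t. deriv \<psi> t *\<^sub>R \<eta> t)"
        by (rule set_integrable_support) (use K KR in auto)
      have "set_integrable lborel K (\<lambda>t. \<psi> t *\<^sub>R g t)"
        by (intro set_integrable_continuous_scaleR \<psi>c g K(1) K')
      then show "set_integrable lborel {0<..R} (\<lambda>t. \<psi> t *\<^sub>R g t)"
        by (rule set_integrable_support) (use K KR in auto)
    qed
    have split: "(LINT t:{0<..<T}|lborel. f t) =
        (LINT t:{0<..s}|lborel. f t) + (LINT t:{s<..R}|lborel. f t)"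
      if "set_integrable lborel {0<..R} f" "\<And>t. t \<notin> K \<Longrightarrow> f t = 0"
      for f :: "real \<Rightarrow> real ^ 'n"
    proof -
      have "(LINT t:{0<..<T}|lborel. f t) = (LINT t:{0<..R}|lborel. f t)"
        by (rule LINT_support_eq[symmetric]) (rule R(1), rule that(2), use K(2) in auto)
      also have "{0<..R} = {0<..s} \<union> {s<..R}" using s R(2) by auto
      also have "(LINT t:\<dots>|lborel. f t) = (LINT t:{0<..s}|lborel. f t) + (LINT t:{s<..R}|lborel. f t)"
        by (rule set_integral_Un) (use s R(2) in \<open>auto intro!: set_integrable_subset[OF that(1)]\<close>)
      finally show ?thesis .
    qed
    have "(LINT t:{0<..s}|lborel. deriv \<psi> t *\<^sub>R \<eta> t) = \<psi> s *\<^sub>R v - (LINT t:{0<..s}|lborel. \<psi> t *\<^sub>R g t)"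
    proof (cases "s = 0")
      case True
      then show ?thesis using \<psi>0 by (simp add: set_lebesgue_integral_def)
    next
      case False
      then have "0 < s" using s by simp
      \<comment> \<open>Translating \<phi> by the constant \<open>v - \<phi> s\<close> contributes
        \<open>\<psi> s *\<^sub>R (v - \<phi> s)\<close>, which turns the boundary value
        \<open>\<phi> s\<close> into \<open>v\<close>.\<close>
      have "(LINT t:{0<..s}|lborel. deriv \<psi> t *\<^sub>R \<eta> t)
          = (LINT t:{0<..s}|lborel. deriv \<psi> t *\<^sub>R \<phi> t + deriv \<psi> t *\<^sub>R (v - \<phi> s))"
        by (rule set_lebesgue_integral_cong) (auto simp: \<eta>_def algebra_simps)
      also have "\<dots> = (LINT t:{0<..s}|lborel. deriv \<psi> t *\<^sub>R \<phi> t)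
          + (LINT t:{0<..s}|lborel. deriv \<psi> t *\<^sub>R (v - \<phi> s))"
      proof (rule set_integral_add)
        have c: "compact (K \<inter> {..s})" using K by (intro compact_Int_closed) auto
        have c': "K \<inter> {..s} \<subseteq> {0<..<s + 1}" using K(2) by auto
        have ints: "set_integrable lborel (K \<inter> {..s}) (\<lambda>t. deriv \<psi> t *\<^sub>R \<phi> t)"
          "set_integrable lborel (K \<inter> {..s}) (\<lambda>t. deriv \<psi> t *\<^sub>R (v - \<phi> s))"
          by (intro set_integrable_compact_continuous continuous_intros \<psi>c c
              continuous_on_subset[OF \<phi> c'])+
        show "set_integrable lborel {0<..s} (\<lambda>t. deriv \<psi> t *\<^sub>R \<phi> t)"
          by (rule set_integrable_support[OF ints(1)]) (use K in auto)
        show "set_integrable lborel {0<..s} (\<lambda>t. deriv \<psi> t *\<^sub>R (v - \<phi> s))"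
          by (rule set_integrable_support[OF ints(2)]) (use K in auto)
      qed
      also have "(LINT t:{0<..s}|lborel. deriv \<psi> t *\<^sub>R \<phi> t)
          = \<psi> s *\<^sub>R \<phi> s - (LINT t:{0<..s}|lborel. \<psi> t *\<^sub>R V t)"
        using \<open>0 < s\<close> by (intro weak_deriv_by_parts[OF weak \<phi> test']) auto
      also have "(LINT t:{0<..s}|lborel. \<psi> t *\<^sub>R V t) = (LINT t:{0<..s}|lborel. \<psi> t *\<^sub>R g t)"
        by (rule set_lebesgue_integral_cong) (auto simp: g_def)
      also have "(LINT t:{0<..s}|lborel. deriv \<psi> t *\<^sub>R (v - \<phi> s)) = \<psi> s *\<^sub>R (v - \<phi> s)"
      proof -
        have "(LINT t:{0..s}|lborel. deriv \<psi> t *\<^sub>R (v - \<phi> s)) = \<psi> s *\<^sub>R (v - \<phi> s) - \<psi> 0 *\<^sub>R (v - \<phi> s)"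
          unfolding set_lebesgue_integral_def
        proof (rule integral_FTC_atLeastAtMost)
          fix t
          have "((\<lambda>t. \<psi> t *\<^sub>R (v - \<phi> s)) has_vector_derivative deriv \<psi> t *\<^sub>R (v - \<phi> s)) (at t)"
            using has_vector_derivative_scaleR[OF \<psi>(1) has_vector_derivative_const] by simp
          then show "((\<lambda>t. \<psi> t *\<^sub>R (v - \<phi> s)) has_vector_derivative deriv \<psi> t *\<^sub>R (v - \<phi> s))
              (at t within {0..s})" by (rule has_vector_derivative_at_within)
        qed (use s in \<open>auto intro!: continuous_intros \<psi>c\<close>)
        then show ?thesis by (simp add: LINT_Ioc_eq_Icc \<psi>0)
      qed
      finally show ?thesis by (simp add: algebra_simps)
    qed
    moreover have "(LINT t:{s<..R}|lborel. deriv \<psi> t *\<^sub>R \<eta> t) =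
        - (\<psi> s *\<^sub>R v) - (LINT t:{s<..R}|lborel. \<psi> t *\<^sub>R g t)"
    proof -
      let ?\<gamma> = "unit_time_segment v w s" and ?h = "segment_velocity v w s"
      have i1: "set_integrable lborel {s..R} (\<lambda>t. deriv \<psi> t *\<^sub>R ?\<gamma> t)"
        by (intro set_integrable_compact_continuous continuous_intros \<psi>c
            continuous_on_unit_time_segment) auto
      have "set_integrable lborel {s..R} ?h"
        unfolding set_integrable_def by (intro integrable_mult_indicator integrable_segment_velocity) auto
      then have i2: "set_integrable lborel {s..R} (\<lambda>t. \<psi> t *\<^sub>R ?h t)"
        by (intro set_integrable_continuous_scaleR \<psi>c) auto
      have "((\<lambda>t. deriv \<psi> t *\<^sub>R ?\<gamma> t + \<psi> t *\<^sub>R ?h t) has_integral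
          (\<psi> R *\<^sub>R ?\<gamma> R - \<psi> s *\<^sub>R ?\<gamma> s)) {s..R}"
      \<comment> \<open>The segment may have a corner at \<open>s + 1\<close>, so this point is
        exempted.\<close>
      proof (rule fundamental_theorem_of_calculus_interior_strong[of "{s + 1}"])
        show "continuous_on {s..R} (\<lambda>t. \<psi> t *\<^sub>R ?\<gamma> t)"
          by (intro continuous_intros \<psi>c continuous_on_unit_time_segment)
        fix t assume "t \<in> {s<..<R} - {s + 1}"
        then have "(?\<gamma> has_vector_derivative ?h t) (at t)"
          by (intro unit_time_segment_has_vector_derivative) auto
        from has_vector_derivative_scaleR[OF \<psi>(1) this]
        show "((\<lambda>t. \<psi> t *\<^sub>R ?\<gamma> t) has_vector_derivative deriv \<psi> t *\<^sub>R ?\<gamma> t + \<psi> t *\<^sub>R ?h t) (at t)"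
          by (simp add: add.commute)
      qed (use R in auto)
      then have "integral {s..R} (\<lambda>t. deriv \<psi> t *\<^sub>R ?\<gamma> t + \<psi> t *\<^sub>R ?h t) = - (\<psi> s *\<^sub>R v)"
        using \<psi>R by (simp add: integral_unique)
      then have "(LINT t:{s..R}|lborel. deriv \<psi> t *\<^sub>R ?\<gamma> t) + (LINT t:{s..R}|lborel. \<psi> t *\<^sub>R ?h t)
          = - (\<psi> s *\<^sub>R v)"
        using set_borel_integral_eq_integral(2)[OF set_integral_add(1)[OF i1 i2]]
          set_integral_add(2)[OF i1 i2] by simp
      moreover have "(LINT t:{s<..R}|lborel. deriv \<psi> t *\<^sub>R \<eta> t) = (LINT t:{s<..R}|lborel. deriv \<psi> t *\<^sub>R ?\<gamma> t)"
        "(LINT t:{s<..R}|lborel. \<psi> t *\<^sub>R g t) = (LINT t:{s<..R}|lborel. \<psi> t *\<^sub>R ?h t)"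
        by (rule set_lebesgue_integral_cong; simp add: \<eta>_def g_def)+
      ultimately show ?thesis by (simp add: LINT_Ioc_eq_Icc algebra_simps)
    qed
    ultimately show "(LINT t:{0<..<T}|lborel. deriv \<psi> t *\<^sub>R \<eta> t) = - (LINT t:{0<..<T}|lborel. \<psi> t *\<^sub>R g t)"
      using split[OF int(1)] split[OF int(2)] K by simp
  qed
qed

section \<open>Competitors\<close>

lemma continuous_on_to_torus [continuous_intros]:
  fixes f :: "'b::topological_space \<Rightarrow> real ^ 'a::finite"
  shows "continuous_on A f \<Longrightarrow> continuous_on A (\<lambda>t. to_torus (f t))"
proof -
  have "continuous_on UNIV (to_torus :: real ^ 'a \<Rightarrow> 'a::finite torus)"
    unfolding continuous_on_iff
    by (metis dist_norm dist_torus_le le_less_trans)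
  then show "continuous_on A f \<Longrightarrow> continuous_on A (\<lambda>t. to_torus (f t))"
    by (rule continuous_on_compose2) auto
qed

lemma torus_H1_loc_continuous_on:
  fixes \<Phi> :: "real \<Rightarrow> 'n::finite torus"
  assumes "torus_H1_loc \<Phi>"
  shows "continuous_on {0..} \<Phi>"
  unfolding continuous_on_eq_continuous_within
proof
  fix x :: real assume "x \<in> {0..}"
  then have "continuous_on {0..x + 1} \<Phi>"
    using assms unfolding torus_H1_loc_def torus_H1_def by auto
  then have "continuous (at x within {0..x + 1}) \<Phi>"
    using \<open>x \<in> {0..}\<close> by (auto simp: continuous_on_eq_continuous_within)
  moreover have "at x within {0..x + 1} = at x within {0..}"
    by (rule at_within_nhd[of x "{..<x + 1}"]) auto
  ultimately show "continuous (at x within {0..}) \<Phi>" by (simp add: continuous_within)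
qed

lemma set_integrable_velocity:
  fixes \<Phi> :: "real \<Rightarrow> 'n::finite torus"
  assumes "torus_H1_loc \<Phi>" "compact K" "K \<subseteq> {0<..}"
  shows "set_integrable lborel K (velocity \<Phi>)"
proof -
  obtain B where "\<And>t. t \<in> K \<Longrightarrow> \<bar>t\<bar> \<le> B"
    using compact_imp_bounded[OF assms(2)] by (auto simp: bounded_iff)
  then have "K \<subseteq> {0<..<\<bar>B\<bar> + 1}" using assms(3) by fastforce
  moreover have "has_torus_weak_deriv_on \<Phi> (velocity \<Phi>) {0<..<\<bar>B\<bar> + 1}"
    by (rule velocity_has_torus_weak_deriv[OF assms(1)]) simp
  ultimately show ?thesis using assms(2)
    unfolding has_torus_weak_deriv_on_def has_weak_deriv_on_def locally_integrable_on_def by blast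
qed

text \<open>A pointwise limit of truncations to compact sets. It is needed because
  \<open>lborel\<close> is not complete: almost everywhere equality with a measurable function does
  not make \<open>velocity\<close> measurable.\<close>

lemma set_borel_measurable_velocity:
  fixes \<Phi> :: "real \<Rightarrow> 'n::finite torus"
  assumes "torus_H1_loc \<Phi>"
  shows "set_borel_measurable lborel {0<..} (velocity \<Phi>)"
  unfolding set_borel_measurable_def
proof (rule borel_measurable_LIMSEQ_metric)
  let ?K = "\<lambda>m :: nat. {1 / (real m + 1)..real m + 1}"
  show "(\<lambda>t. indicator (?K m) t *\<^sub>R velocity \<Phi> t) \<in> borel_measurable lborel" for m
  proof -
    have "?K m \<subseteq> {0<..}" by (auto intro: less_le_trans[rotated])
    from set_integrable_velocity[OF assms compact_Icc this] show ?thesis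
      unfolding set_integrable_def by (rule borel_measurable_integrable)
  qed
  fix t :: real
  show "(\<lambda>m. indicator (?K m) t *\<^sub>R velocity \<Phi> t) \<longlonglongrightarrow> indicator {0<..} t *\<^sub>R velocity \<Phi> t"
  proof (cases "t > 0")
    case True
    obtain k :: nat where k: "real k > max t (1 / t)" using reals_Archimedean2 by blast
    have "\<forall>\<^sub>F m in sequentially. t \<in> ?K m"
      using eventually_ge_at_top[of k]
    proof eventually_elim
      case (elim m)
      then have m: "t < real m" "1 / t < real m + 1" using k by auto
      then have "1 / (real m + 1) \<le> t" using True by (simp add: field_simps)
      with m show ?case by simp
    qed
    then have "\<forall>\<^sub>F m in sequentially.
        indicator (?K m) t *\<^sub>R velocity \<Phi> t = indicator {0<..} t *\<^sub>R velocity \<Phi> t"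
      by eventually_elim (use True in simp)
    then show ?thesis by (rule tendsto_eventually)
  next
    case False
    have "t \<notin> ?K m" for m
    proof -
      have "1 / (real m + 1) > 0" by simp
      with False have "\<not> 1 / (real m + 1) \<le> t" by linarith
      then show ?thesis by simp
    qed
    with False show ?thesis by simp
  qed
qed

text \<open>Continuity along the curve settles the potential on a bounded interval; the kinetic part
  is then obtained by subtracting it from the integrable lagrangian.\<close>

lemma admissible_integrable:
  fixes \<Phi> :: "real \<Rightarrow> 'n::finite torus"
  assumes Q: "continuous_on UNIV Q" and \<Phi>: "\<Phi> \<in> admissible Q \<Phi>0"
  shows "set_integrable lborel {0<..T} (\<lambda>t. Q (\<Phi> t))"
    and "set_integrable lborel {0<..T} (\<lambda>t. (norm (velocity \<Phi> t))\<^sup>2)"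
proof -
  have H1: "torus_H1_loc \<Phi>" and lag: "set_integrable lborel {0<..} (lagrangian Q \<Phi>)"
    using \<Phi> by (auto simp: admissible_def)
  have "continuous_on {0..T} (\<lambda>t. Q (\<Phi> t))"
    by (rule continuous_on_compose2[OF Q])
      (auto intro: continuous_on_subset[OF torus_H1_loc_continuous_on[OF H1]])
  then have "set_integrable lborel {0..T} (\<lambda>t. Q (\<Phi> t))"
    by (rule set_integrable_compact_continuous[rotated]) simp
  then show 1: "set_integrable lborel {0<..T} (\<lambda>t. Q (\<Phi> t))"
    by (rule set_integrable_subset) auto
  have "set_integrable lborel {0<..T} (lagrangian Q \<Phi>)"
    using lag by (rule set_integrable_subset) auto
  then have "set_integrable lborel {0<..T} (\<lambda>t. 2 * (lagrangian Q \<Phi> t - Q (\<Phi> t)))"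
    using 1 by (intro set_integrable_mult_right set_integral_diff)
  then show "set_integrable lborel {0<..T} (\<lambda>t. (norm (velocity \<Phi> t))\<^sup>2)"
    by (simp add: lagrangian_def)
qed

text \<open>The competitor follows \<open>\<Phi>\<close> up to time \<open>s\<close>, then moves in unit time along a segment to a zero
  of \<open>Q\<close>, where it stays.\<close>

lemma append_segment_admissible:
  fixes \<Phi> :: "real \<Rightarrow> 'n::finite torus"
  assumes Q: "continuous_on UNIV Q" and \<Phi>: "\<Phi> \<in> admissible Q \<Phi>0" and s: "s \<ge> 0"
    and v: "to_torus v = \<Phi> s" and w: "Q (to_torus w) = 0"
  defines "\<Psi> \<equiv> \<lambda>t. if t \<le> s then \<Phi> t else to_torus (unit_time_segment v w s t)"
  shows "\<Psi> \<in> admissible Q \<Phi>0"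
    and "action Q \<Psi> = (LINT t:{0<..s}|lborel. lagrangian Q \<Phi> t)
      + (LINT t:{s<..s + 1}|lborel. (norm (w - v))\<^sup>2 / 2 + Q (to_torus (unit_time_segment v w s t)))"
proof -
  let ?V = "velocity \<Phi>" and ?\<gamma> = "unit_time_segment v w s" and ?h = "segment_velocity v w s"
  have H1: "torus_H1_loc \<Phi>" and \<Phi>0: "\<Phi> 0 = \<Phi>0"
    and lag: "set_integrable lborel {0<..} (lagrangian Q \<Phi>)"
    using \<Phi> by (auto simp: admissible_def)
  have "has_torus_weak_deriv_on \<Phi> ?V {0<..<s + 1}"
    using s by (intro velocity_has_torus_weak_deriv[OF H1]) auto
  then obtain \<phi> where \<phi>: "continuous_on {0<..<s + 1} \<phi>" "has_weak_deriv_on \<phi> ?V {0<..<s + 1}"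
    "\<And>t. t \<in> {0<..<s + 1} \<Longrightarrow> to_torus (\<phi> t) = \<Phi> t"
    unfolding has_torus_weak_deriv_on_def by blast
  define \<eta> where "\<eta> = (\<lambda>t. if t \<le> s then \<phi> t - \<phi> s + v else ?\<gamma> t)"
  define g where "g = (\<lambda>t. if t \<le> s then ?V t else ?h t)"
  note append = has_weak_deriv_on_append_segment[OF s \<phi>(2,1), of v w, folded \<eta>_def g_def]
  have lift: "to_torus (\<eta> t) = \<Psi> t" if "t > 0" for t
  proof (cases "t \<le> s")
    case True
    \<comment> \<open>\<open>v\<close> and \<open>\<phi> s\<close> represent the same point, so the
      translation in \<eta> is by a period and is invisible on the torus.\<close>
    then have "to_torus v = to_torus (\<phi> s)" using \<phi>(3)[of s] v that by auto
    then have "torus_rel (\<phi> t - \<phi> s + v) (\<phi> t)"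
      by (simp add: to_torus_eq_iff torus_rel_def)
    then show ?thesis using \<phi>(3)[of t] True that by (simp add: \<eta>_def \<Psi>_def to_torus_eq_iff[symmetric])
  qed (simp add: \<eta>_def \<Psi>_def)
  have weak: "has_torus_weak_deriv_on \<Psi> g {0<..<T}" for T
    unfolding has_torus_weak_deriv_on_def
    using append(2) lift by (intro exI[of _ \<eta>]) (auto intro: continuous_on_subset[OF append(1)])
  have "continuous_on ({0..s} \<union> {s..}) \<Psi>"
    unfolding \<Psi>_def
  proof (rule continuous_on_cases)
    show "continuous_on {0..s} \<Phi>"
      by (rule continuous_on_subset[OF torus_H1_loc_continuous_on[OF H1]]) auto
    show "continuous_on {s..} (\<lambda>t. to_torus (?\<gamma> t))"
      by (intro continuous_intros continuous_on_unit_time_segment)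
  qed (auto simp: v)
  moreover have "{0..s} \<union> {s..} = {0..}" using s by auto
  ultimately have cont: "continuous_on {0..} \<Psi>" by simp
  have g_sq: "set_integrable lborel {0<..<T} (\<lambda>t. (norm (g t))\<^sup>2)" for T
  proof -
    have "set_integrable lborel {0<..s} (\<lambda>t. (norm (g t))\<^sup>2)"
      by (rule set_integrable_cong[THEN iffD1, rotated 3, OF admissible_integrable(2)[OF Q \<Phi>, of s]])
        (auto simp: g_def)
    moreover have "set_integrable lborel {s<..} (\<lambda>t. (norm (g t))\<^sup>2)"
    proof (rule set_integrable_support[of "{s<..s + 1}"])
      have "set_integrable lborel {s<..s + 1} (\<lambda>t. (norm (w - v))\<^sup>2)"
        by (rule set_integrable_subset[of _ "{s..s + 1}"])
          (auto intro: set_integrable_compact_continuous)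
      then show "set_integrable lborel {s<..s + 1} (\<lambda>t. (norm (g t))\<^sup>2)"
        by (rule set_integrable_cong[THEN iffD1, rotated 3]) (auto simp: g_def segment_velocity_def)
    qed (auto simp: g_def segment_velocity_def)
    ultimately have "set_integrable lborel ({0<..s} \<union> {s<..}) (\<lambda>t. (norm (g t))\<^sup>2)"
      by (intro set_integrable_Un) auto
    then show ?thesis by (rule set_integrable_subset) auto
  qed
  have H1': "torus_H1_loc \<Psi>"
    unfolding torus_H1_loc_def torus_H1_def
    using weak g_sq by (auto intro: continuous_on_subset[OF cont])
  \<comment> \<open>The lagrangian of the competitor with the chosen velocity replaced by the
    explicit \<open>g\<close>.\<close>
  define \<theta> where "\<theta> t = (norm (g t))\<^sup>2 / 2 + Q (\<Psi> t)" for t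
  have AE_eq: "AE t in lborel. t > 0 \<longrightarrow> lagrangian Q \<Psi> t = \<theta> t"
    using velocity_AE_unique[OF H1' weak] by eventually_elim (simp add: lagrangian_def \<theta>_def)
  have "set_integrable lborel {0<..s} (lagrangian Q \<Phi>)"
    using lag by (rule set_integrable_subset) auto
  then have \<theta>1: "set_integrable lborel {0<..s} \<theta>"
    by (rule set_integrable_cong[THEN iffD1, rotated 3])
      (auto simp: g_def \<theta>_def \<Psi>_def lagrangian_def)
  have "continuous_on {s..s + 1} (\<lambda>t. (norm (w - v))\<^sup>2 / 2 + Q (to_torus (?\<gamma> t)))"
    by (intro continuous_intros continuous_on_compose2[OF Q] continuous_on_unit_time_segment) auto
  then have "set_integrable lborel {s..s + 1} (\<lambda>t. (norm (w - v))\<^sup>2 / 2 + Q (to_torus (?\<gamma> t)))"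
    by (rule set_integrable_compact_continuous[rotated]) simp
  then have "set_integrable lborel {s<..s + 1} (\<lambda>t. (norm (w - v))\<^sup>2 / 2 + Q (to_torus (?\<gamma> t)))"
    by (rule set_integrable_subset) auto
  then have "set_integrable lborel {s<..s + 1} \<theta>"
    by (rule set_integrable_cong[THEN iffD1, rotated 3])
      (auto simp: g_def \<theta>_def \<Psi>_def segment_velocity_def)
  \<comment> \<open>After \<open>s + 1\<close> the competitor rests at a zero of \<open>Q\<close>;
    this is what keeps its action finite.\<close>
  moreover have \<theta>_zero: "\<theta> t = 0" if "t > s + 1" for t
    using that w by (simp add: \<theta>_def g_def \<Psi>_def segment_velocity_def unit_time_segment_def)
  ultimately have \<theta>2: "set_integrable lborel {s<..} \<theta>"
    by (intro set_integrable_support[of "{s<..s + 1}" _ "{s<..}"]) auto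
  have split: "{0<..s} \<union> {s<..} = {0<..}" using s by auto
  have \<theta>: "set_integrable lborel {0<..} \<theta>"
    using set_integrable_Un[OF \<theta>1 \<theta>2] split by simp
  have "continuous_on {0<..} (\<lambda>t. Q (\<Psi> t))"
    by (rule continuous_on_compose2[OF Q]) (auto intro: continuous_on_subset[OF cont])
  then have "(\<lambda>t. indicator {0<..} t *\<^sub>R Q (\<Psi> t)) \<in> borel_measurable lborel"
    using borel_measurable_continuous_on_indicator[of "{0<..}" "\<lambda>t. Q (\<Psi> t)"] by simp
  moreover have "(\<lambda>t. indicator {0<..} t *\<^sub>R velocity \<Psi> t) \<in> borel_measurable lborel"
    using set_borel_measurable_velocity[OF H1'] by (simp add: set_borel_measurable_def)
  ultimately have "(\<lambda>t. 1 / 2 * (norm (indicator {0<..} t *\<^sub>R velocity \<Psi> t))\<^sup>2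
      + indicator {0<..} t *\<^sub>R Q (\<Psi> t)) \<in> borel_measurable lborel"
    by measurable
  also have "(\<lambda>t. 1 / 2 * (norm (indicator {0<..} t *\<^sub>R velocity \<Psi> t))\<^sup>2
      + indicator {0<..} t *\<^sub>R Q (\<Psi> t)) = (\<lambda>t. indicator {0<..} t *\<^sub>R lagrangian Q \<Psi> t)"
    by (auto simp: lagrangian_def split: split_indicator)
  finally have meas: "(\<lambda>t. indicator {0<..} t *\<^sub>R lagrangian Q \<Psi> t) \<in> borel_measurable lborel" .
  have AE_eq': "AE t in lborel. indicator {0<..} t *\<^sub>R \<theta> t = indicator {0<..} t *\<^sub>R lagrangian Q \<Psi> t"
    using AE_eq by eventually_elim (auto split: split_indicator)
  have \<theta>_meas: "(\<lambda>t. indicator {0<..} t *\<^sub>R \<theta> t) \<in> borel_measurable lborel"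
    using \<theta> unfolding set_integrable_def by (rule borel_measurable_integrable)
  have "set_integrable lborel {0<..} (lagrangian Q \<Psi>)"
    using \<theta> integrable_cong_AE[OF \<theta>_meas meas AE_eq'] by (simp add: set_integrable_def)
  then show "\<Psi> \<in> admissible Q \<Phi>0"
    using H1' \<Phi>0 s by (simp add: admissible_def \<Psi>_def)
  have "action Q \<Psi> = (LINT t:{0<..}|lborel. \<theta> t)"
    unfolding action_def set_lebesgue_integral_def
    using integral_cong_AE[OF \<theta>_meas meas AE_eq'] by simp
  also have "\<dots> = (LINT t:{0<..s}|lborel. \<theta> t) + (LINT t:{s<..}|lborel. \<theta> t)"
    unfolding split[symmetric] by (rule set_integral_Un[OF _ \<theta>1 \<theta>2]) auto
  also have "(LINT t:{0<..s}|lborel. \<theta> t) = (LINT t:{0<..s}|lborel. lagrangian Q \<Phi> t)"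
    by (rule set_lebesgue_integral_cong) (auto simp: g_def \<theta>_def \<Psi>_def lagrangian_def)
  also have "(LINT t:{s<..}|lborel. \<theta> t) = (LINT t:{s<..s + 1}|lborel. \<theta> t)"
    by (rule LINT_support_eq) (use \<theta>_zero in auto)
  also have "\<dots> = (LINT t:{s<..s + 1}|lborel. (norm (w - v))\<^sup>2 / 2 + Q (to_torus (?\<gamma> t)))"
    by (rule set_lebesgue_integral_cong) (auto simp: g_def \<theta>_def \<Psi>_def segment_velocity_def)
  finally show "action Q \<Psi> = (LINT t:{0<..s}|lborel. lagrangian Q \<Phi> t)
      + (LINT t:{s<..s + 1}|lborel. (norm (w - v))\<^sup>2 / 2 + Q (to_torus (?\<gamma> t)))" .
qed

section \<open>Energy estimates\<close>

text \<open>Shifting each coordinate of \<open>w\<close> by a multiple of 2 pi brings every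
  coordinate difference into [0, 2 pi). This is the origin of 2 pi sqrt n in the constants; rounding
  to the nearest multiple would halve it.\<close>

lemma torus_dist_le_diameter:
  fixes x y :: "'n::finite torus"
  shows "dist x y \<le> 2 * pi * sqrt (real CARD('n))"
proof -
  obtain v w where v: "x = to_torus v" and w: "y = to_torus w" by (metis to_torus_cases)
  define w' where "w' = (\<chi> i. w $ i + 2 * pi * of_int \<lfloor>(v $ i - w $ i) / (2 * pi)\<rfloor>)"
  have "torus_rel w' w"
    unfolding torus_rel_def w'_def by auto
  then have "y = to_torus w'" using w to_torus_eq_iff by metis
  then have "dist x y \<le> norm (v - w')" using v dist_torus_le by metis
  also have "norm (v - w') \<le> L2_set (\<lambda>_. 2 * pi) (UNIV :: 'n set)"
    unfolding norm_vec_def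
  proof (rule L2_set_mono)
    fix i
    define q where "q = (v $ i - w $ i) / (2 * pi)"
    have "v $ i - w $ i = 2 * pi * q" by (simp add: q_def)
    then have "(v - w') $ i = 2 * pi * frac ((v $ i - w $ i) / (2 * pi))"
      by (simp add: w'_def frac_def right_diff_distrib q_def[symmetric])
    then show "norm ((v - w') $ i) \<le> 2 * pi"
      using frac_lt_1[of "(v $ i - w $ i) / (2 * pi)"] by (simp add: abs_mult)
  qed simp
  also have "\<dots> = 2 * pi * sqrt (real CARD('n))"
    by (simp add: L2_set_constant)
  finally show ?thesis .
qed

text \<open>Works with a slack \<open>e\<close> instead of an attained infimum; the slack tends to 0
  in \<open>tail_energy_le\<close>.\<close>

lemma torus_infdist_approx:
  fixes x :: "'n::finite torus"
  assumes "Z \<noteq> {}" "e > 0"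
  obtains v w where "to_torus v = x" "to_torus w \<in> Z" "norm (v - w) < infdist x Z + e"
proof -
  have "(INF z\<in>Z. dist x z) < infdist x Z + e"
    using assms by (simp add: infdist_notempty)
  then obtain z where z: "z \<in> Z" "dist x z < infdist x Z + e"
    using assms(1) by (auto dest!: cInf_lessD[rotated])
  \<comment> \<open>The slack is chosen so that the bound collapses to
    \<open>infdist x Z + e\<close>.\<close>
  obtain v w where "to_torus v = x" "to_torus w = z" "norm (v - w) < dist x z + (infdist x Z + e - dist x z)"
    using z by (metis diff_gt_0_iff_gt dist_torus_approx)
  with z show ?thesis by (intro that[of v w]) auto
qed

lemma torus_Lipschitz_continuous_on:
  fixes Q :: "'n::finite torus \<Rightarrow> real"
  assumes L: "L \<ge> 0" and Lip: "\<And>v w. \<bar>Q (to_torus v) - Q (to_torus w)\<bar> \<le> L * norm (v - w)"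
  shows "continuous_on UNIV Q"
  unfolding continuous_on_iff
proof (intro ballI allI impI)
  fix x :: "'n torus" and e :: real assume "e > 0"
  show "\<exists>d>0. \<forall>y\<in>UNIV. dist y x < d \<longrightarrow> dist (Q y) (Q x) < e"
  proof (intro exI[of _ "e / (L + 1)"] conjI ballI impI)
    show "0 < e / (L + 1)" using L \<open>e > 0\<close> by simp
    fix y assume "dist y x < e / (L + 1)"
    then obtain v w where vw: "to_torus v = y" "to_torus w = x"
      "norm (v - w) < dist y x + (e / (L + 1) - dist y x)"
      by (metis diff_gt_0_iff_gt dist_torus_approx)
    have "L * norm (v - w) \<le> (L + 1) * norm (v - w)" by (intro mult_right_mono) auto
    also have "\<dots> < e" using vw(3) L by (simp add: field_simps)
    finally show "dist (Q y) (Q x) < e" using Lip[of v w] vw by (simp add: dist_real_def)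
  qed
qed

lemma LINT_mono_set:
  fixes f :: "real \<Rightarrow> real"
  assumes "set_integrable lborel B f" "A \<in> sets lborel" "A \<subseteq> B" "\<And>t. t \<in> B \<Longrightarrow> 0 \<le> f t"
  shows "(LINT t:A|lborel. f t) \<le> (LINT t:B|lborel. f t)"
  using assms set_integrable_subset[OF assms(1-3)]
  unfolding set_lebesgue_integral_def set_integrable_def
  by (intro integral_mono) (auto split: split_indicator)

text \<open>A pointwise form of Cauchy-Schwarz: with r the displacement and V the velocity, r * norm
  V is at most (r^2 + (norm V)^2) / 2. The integral of norm V is at least r, so integrating over a
  length of at most 1 bounds r^2 by r^2 / 2 plus the action on the interval.\<close>

lemma admissible_displacement:
  fixes \<Phi> :: "real \<Rightarrow> 'n::finite torus"
  assumes Q: "continuous_on UNIV Q" "\<And>x. 0 \<le> Q x" and \<Phi>: "\<Phi> \<in> admissible Q \<Phi>0"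
    and ab: "0 < a" "a \<le> b" "b \<le> a + 1"
  shows "(dist (\<Phi> a) (\<Phi> b))\<^sup>2 \<le> 2 * (LINT t:{a<..b}|lborel. lagrangian Q \<Phi> t)"
proof -
  let ?V = "velocity \<Phi>" and ?r = "dist (\<Phi> a) (\<Phi> b)"
  have H1: "torus_H1_loc \<Phi>" and lag: "set_integrable lborel {0<..} (lagrangian Q \<Phi>)"
    using \<Phi> by (auto simp: admissible_def)
  have "has_torus_weak_deriv_on \<Phi> ?V {0<..<b + 1}"
    using ab by (intro velocity_has_torus_weak_deriv[OF H1]) auto
  then obtain \<phi> where \<phi>: "continuous_on {0<..<b + 1} \<phi>" "has_weak_deriv_on \<phi> ?V {0<..<b + 1}"
    "\<And>t. t \<in> {0<..<b + 1} \<Longrightarrow> to_torus (\<phi> t) = \<Phi> t"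
    unfolding has_torus_weak_deriv_on_def by blast
  have "set_integrable lborel {a..b} ?V"
    using ab by (intro set_integrable_velocity[OF H1]) auto
  then have V: "set_integrable lborel {a<..b} ?V" by (rule set_integrable_subset) auto
  have V2: "set_integrable lborel {a<..b} (\<lambda>t. (norm (?V t))\<^sup>2)"
    by (rule set_integrable_subset[OF admissible_integrable(2)[OF Q(1) \<Phi>, of b]]) (use ab in auto)
  have lag': "set_integrable lborel {a<..b} (lagrangian Q \<Phi>)"
    using lag by (rule set_integrable_subset) (use ab in auto)
  have V_norm: "set_integrable lborel {a<..b} (\<lambda>t. norm (?V t))"
    using V unfolding set_integrable_def by (auto dest: integrable_norm)
  have const: "set_integrable lborel {a<..b} (\<lambda>t. c)" for c :: real
    by (rule set_integrable_subset[of _ "{a..b}"]) (auto intro: set_integrable_compact_continuous)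
  have "?r \<le> norm (\<phi> a - \<phi> b)" using \<phi>(3)[of a] \<phi>(3)[of b] dist_torus_le[of "\<phi> a" "\<phi> b"] ab by simp
  also have "\<dots> = norm (\<phi> b - \<phi> a)" by (rule norm_minus_commute)
  also have "\<dots> = norm (LINT t:{a<..b}|lborel. ?V t)"
    using weak_deriv_FTC[OF \<phi>(2,1), of a b] ab by simp
  also have "\<dots> \<le> (LINT t:{a<..b}|lborel. norm (?V t))" by (rule set_integral_norm_bound[OF V])
  finally have "?r * ?r \<le> ?r * (LINT t:{a<..b}|lborel. norm (?V t))" by (intro mult_left_mono) auto
  also have "\<dots> = (LINT t:{a<..b}|lborel. ?r * norm (?V t))" by simp
  also have "\<dots> \<le> (LINT t:{a<..b}|lborel. ?r\<^sup>2 / 2 + lagrangian Q \<Phi> t)"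
  proof (rule set_integral_mono)
    show "set_integrable lborel {a<..b} (\<lambda>t. ?r * norm (?V t))" using V_norm by simp
    show "set_integrable lborel {a<..b} (\<lambda>t. ?r\<^sup>2 / 2 + lagrangian Q \<Phi> t)"
      by (intro set_integral_add(1) const lag')
    fix t
    have "0 \<le> (?r - norm (?V t))\<^sup>2" by simp
    then show "?r * norm (?V t) \<le> ?r\<^sup>2 / 2 + lagrangian Q \<Phi> t"
      using Q(2)[of "\<Phi> t"] by (simp add: lagrangian_def power2_diff)
  qed
  also have "\<dots> = (LINT t:{a<..b}|lborel. ?r\<^sup>2 / 2) + (LINT t:{a<..b}|lborel. lagrangian Q \<Phi> t)"
    by (intro set_integral_add(2) const lag')
  also have "(LINT t:{a<..b}|lborel. ?r\<^sup>2 / 2) = (b - a) * (?r\<^sup>2 / 2)"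
    using ab by (simp add: set_lebesgue_integral_def)
  also have "\<dots> \<le> 1 * (?r\<^sup>2 / 2)" using ab by (intro mult_right_mono) auto
  finally show ?thesis by (simp add: power2_eq_square)
qed

lemma le_powr_inverse:
  fixes x y p :: real
  assumes "0 \<le> x" "0 < p" "x powr p \<le> y"
  shows "x \<le> y powr (1 / p)"
proof -
  have "x = (x powr p) powr (1 / p)" using assms by (simp add: powr_powr)
  also have "\<dots> \<le> y powr (1 / p)" using assms by (intro powr_mono2) auto
  finally show ?thesis .
qed

section \<open>Estimates for a fixed minimizer\<close>

context
  fixes Q :: "'n::finite torus \<Rightarrow> real" and L :: real and \<Phi>0 :: "'n torus"
    and \<Phi> :: "real \<Rightarrow> 'n torus" and Z :: "'n torus set" and M :: real
  assumes Q_nonneg: "\<And>x. 0 \<le> Q x"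
    and L_nonneg: "L \<ge> 0"
    and Lip: "\<And>v w. \<bar>Q (to_torus v) - Q (to_torus w)\<bar> \<le> L * norm (v - w)"
    and Z: "Z = {x. Q x = 0}" "Z \<noteq> {}"
    and adm: "\<Phi> \<in> admissible Q \<Phi>0"
    and min: "\<And>\<Psi>. \<Psi> \<in> admissible Q \<Phi>0 \<Longrightarrow> action Q \<Phi> \<le> action Q \<Psi>"
    and M: "M = 2 * pi * sqrt (real CARD('n))"
begin

lemma Q_continuous: "continuous_on UNIV Q"
  by (rule torus_Lipschitz_continuous_on[OF L_nonneg Lip])

lemma lagrangian_nonneg: "0 \<le> lagrangian Q \<Phi> t"
  by (simp add: lagrangian_def Q_nonneg)

lemma lagrangian_integrable: "S \<in> sets lborel \<Longrightarrow> S \<subseteq> {0<..} \<Longrightarrow> set_integrable lborel S (lagrangian Q \<Phi>)"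
  using adm by (auto simp: admissible_def elim: set_integrable_subset)

lemma infdist_le_diameter: "infdist x Z \<le> M"
proof -
  obtain z where "z \<in> Z" using Z(2) by blast
  then have "infdist x Z \<le> dist x z" by (rule infdist_le)
  also have "\<dots> \<le> M" unfolding M by (rule torus_dist_le_diameter)
  finally show ?thesis .
qed

text \<open>The competitor shares the action up to \<open>s\<close>, so minimality compares the
  tails. At time \<open>t\<close> the segment is at distance (s + 1 - t) * norm (v - w) from a zero
  of \<open>Q\<close>, hence \<open>Q\<close> is at most \<open>L\<close> times this; averaging s +
  1 - t over the unit interval gives the factor 1/2.\<close>

lemma tail_energy_le_segment:
  assumes s: "s \<ge> 0" and v: "to_torus v = \<Phi> s" and w: "to_torus w \<in> Z"
  shows "(LINT t:{s<..}|lborel. lagrangian Q \<Phi> t) \<le> ((norm (v - w))\<^sup>2 + L * norm (v - w)) / 2"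
proof -
  let ?\<gamma> = "unit_time_segment v w s" and ?\<delta> = "norm (v - w)"
  have w0: "Q (to_torus w) = 0" using w Z by simp
  note competitor = append_segment_admissible[OF Q_continuous adm s v w0]
  have split: "{0<..} = {0<..s} \<union> {s<..}" using s by auto
  have "(LINT t:{0<..s}|lborel. lagrangian Q \<Phi> t) + (LINT t:{s<..}|lborel. lagrangian Q \<Phi> t)
      = action Q \<Phi>"
    unfolding action_def split
    by (rule set_integral_Un[symmetric]) (use s in \<open>auto intro!: lagrangian_integrable\<close>)
  with min[OF competitor(1)] competitor(2)
  have "(LINT t:{s<..}|lborel. lagrangian Q \<Phi> t)
      \<le> (LINT t:{s<..s + 1}|lborel. (norm (w - v))\<^sup>2 / 2 + Q (to_torus (?\<gamma> t)))" by simp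
  also have "\<dots> \<le> (LINT t:{s<..s + 1}|lborel. ?\<delta>\<^sup>2 / 2 + L * ?\<delta> * (s + 1 - t))"
  proof (rule set_integral_mono)
    show "set_integrable lborel {s<..s + 1} (\<lambda>t. (norm (w - v))\<^sup>2 / 2 + Q (to_torus (?\<gamma> t)))"
      by (rule set_integrable_subset[of _ "{s..s + 1}"])
        (auto intro!: set_integrable_compact_continuous continuous_intros
          continuous_on_compose2[OF Q_continuous] continuous_on_unit_time_segment)
    show "set_integrable lborel {s<..s + 1} (\<lambda>t. ?\<delta>\<^sup>2 / 2 + L * ?\<delta> * (s + 1 - t))"
      by (rule set_integrable_subset[of _ "{s..s + 1}"])
        (auto intro!: set_integrable_compact_continuous continuous_intros)
    fix t assume t: "t \<in> {s<..s + 1}"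
    have "?\<gamma> t - w = (s + 1 - t) *\<^sub>R (v - w)"
      using t by (simp add: unit_time_segment_def min_def algebra_simps)
    then have "norm (?\<gamma> t - w) = (s + 1 - t) * ?\<delta>" using t by simp
    with Lip[of "?\<gamma> t" w] w0
    show "(norm (w - v))\<^sup>2 / 2 + Q (to_torus (?\<gamma> t)) \<le> ?\<delta>\<^sup>2 / 2 + L * ?\<delta> * (s + 1 - t)"
      by (simp add: norm_minus_commute mult_ac)
  qed
  also have "\<dots> = (LINT t:{s..s + 1}|lborel. ?\<delta>\<^sup>2 / 2 + L * ?\<delta> * (s + 1 - t))"
    by (rule LINT_Ioc_eq_Icc)
  also have "\<dots> = (?\<delta>\<^sup>2 / 2 * (s + 1) - L * ?\<delta> * (s + 1 - (s + 1))\<^sup>2 / 2)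
      - (?\<delta>\<^sup>2 / 2 * s - L * ?\<delta> * (s + 1 - s)\<^sup>2 / 2)"
    unfolding set_lebesgue_integral_def
  proof (rule integral_FTC_atLeastAtMost)
    fix t
    have "((\<lambda>t. ?\<delta>\<^sup>2 / 2 * t - L * ?\<delta> * (s + 1 - t)\<^sup>2 / 2) has_real_derivative
        ?\<delta>\<^sup>2 / 2 + L * ?\<delta> * (s + 1 - t)) (at t within {s..s + 1})"
      by (auto intro!: derivative_eq_intros simp: field_simps)
    then show "((\<lambda>t. ?\<delta>\<^sup>2 / 2 * t - L * ?\<delta> * (s + 1 - t)\<^sup>2 / 2) has_vector_derivative
        ?\<delta>\<^sup>2 / 2 + L * ?\<delta> * (s + 1 - t)) (at t within {s..s + 1})"
      by (simp add: has_real_derivative_iff_has_vector_derivative)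
  qed (auto intro!: continuous_intros)
  also have "\<dots> = (?\<delta>\<^sup>2 + L * ?\<delta>) / 2" by (simp add: algebra_simps add_divide_distrib)
  finally show ?thesis .
qed

text \<open>With D the distance to \<open>Z\<close>, letting the slack tend to 0 gives (D^2 + L * D)
  / 2; bounding one factor D by \<open>M\<close> makes this linear in D.\<close>

lemma tail_energy_le:
  assumes s: "s \<ge> 0"
  shows "(LINT t:{s<..}|lborel. lagrangian Q \<Phi> t) \<le> (M + L) / 2 * infdist (\<Phi> s) Z"
proof -
  let ?D = "infdist (\<Phi> s) Z" and ?E = "LINT t:{s<..}|lborel. lagrangian Q \<Phi> t"
  have "?E \<le> ((?D + e)\<^sup>2 + L * (?D + e)) / 2" if e: "e > 0" for e
  proof -
    obtain v w where vw: "to_torus v = \<Phi> s" "to_torus w \<in> Z" "norm (v - w) < ?D + e"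
      by (rule torus_infdist_approx[OF Z(2) e])
    have "?E \<le> ((norm (v - w))\<^sup>2 + L * norm (v - w)) / 2"
      by (rule tail_energy_le_segment[OF s vw(1,2)])
    also have "\<dots> \<le> ((?D + e)\<^sup>2 + L * (?D + e)) / 2"
      using vw(3) L_nonneg by (intro divide_right_mono add_mono power_mono mult_left_mono) auto
    finally show ?thesis .
  qed
  then have "\<forall>\<^sub>F e in at_right 0. ?E \<le> ((?D + e)\<^sup>2 + L * (?D + e)) / 2"
    using eventually_at_right_less[of "0::real"] by (auto elim: eventually_mono)
  moreover have "((\<lambda>e. ((?D + e)\<^sup>2 + L * (?D + e)) / 2) \<longlongrightarrow> ((?D + 0)\<^sup>2 + L * (?D + 0)) / 2) (at_right 0)"
    by (intro tendsto_intros) auto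
  ultimately have "?E \<le> ((?D + 0)\<^sup>2 + L * (?D + 0)) / 2"
    by (intro tendsto_lowerbound) auto
  also have "\<dots> = (?D * ?D + L * ?D) / 2" by (simp add: power2_eq_square)
  also have "\<dots> \<le> (M * ?D + L * ?D) / 2"
    by (intro divide_right_mono add_mono mult_right_mono infdist_le_diameter infdist_nonneg) auto
  also have "\<dots> = (M + L) / 2 * ?D" by (simp add: algebra_simps)
  finally show ?thesis .
qed

text \<open>During \<open>[t, t + 1]\<close> the curve either halves its distance to \<open>Z\<close>, which costs kinetic energy,
  or stays at least half as far, which costs potential energy.\<close>

lemma infdist_powr_le_tail_energy:
  assumes d: "d > 0" and N: "N > 0"
    and Loj: "\<And>x. \<bar>Q x\<bar> \<ge> d * infdist x Z powr N"
    and N': "N' = max 2 N" and st: "0 \<le> s" "s \<le> t" "0 < t"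
  shows "infdist (\<Phi> t) Z powr N' \<le> max (2 powr (N' + 1) * M powr (N' - 2)) (2 powr N' * M powr (N' - N) / d)
    * (LINT t:{s<..}|lborel. lagrangian Q \<Phi> t)"
proof -
  let ?A = "2 powr (N' + 1) * M powr (N' - 2)" and ?B = "2 powr N' * M powr (N' - N) / d"
  define \<rho> where "\<rho> = infdist (\<Phi> t) Z"
  define E where "E = (LINT t:{s<..}|lborel. lagrangian Q \<Phi> t)"
  have \<rho>: "0 \<le> \<rho>" "\<rho> \<le> M" by (simp_all add: \<rho>_def infdist_nonneg infdist_le_diameter)
  have E_ge: "(LINT t:{a<..b}|lborel. lagrangian Q \<Phi> t) \<le> E" if "t \<le> a" for a b
    unfolding E_def
    by (rule LINT_mono_set) (use st that in \<open>auto intro!: lagrangian_integrable lagrangian_nonneg\<close>)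
  have E: "E \<ge> 0" using E_ge[of t t] by (simp add: set_lebesgue_integral_def)
  show ?thesis unfolding \<rho>_def[symmetric] E_def[symmetric]
  proof (cases "\<rho> = 0")
    \<comment> \<open>Here \<open>0 powr N'\<close> is 0 and a nonnegative right-hand side is
      enough; splitting exponents in the other case relies on \<rho> > 0.\<close>
    case True
    then show "\<rho> powr N' \<le> max ?A ?B * E" using E d by (simp add: le_max_iff_disj)
  next
    case False
    with \<rho> have pos: "\<rho> > 0" by simp
    show "\<rho> powr N' \<le> max ?A ?B * E"
    proof (cases "\<exists>u\<in>{t..t + 1}. infdist (\<Phi> u) Z \<le> \<rho> / 2")
      case True
      then obtain u where u: "u \<in> {t..t + 1}" "infdist (\<Phi> u) Z \<le> \<rho> / 2" by blast
      have "\<rho> / 2 \<le> dist (\<Phi> t) (\<Phi> u)"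
        using infdist_triangle[of "\<Phi> t" Z "\<Phi> u"] u(2) by (simp add: \<rho>_def)
      then have "(\<rho> / 2)\<^sup>2 \<le> (dist (\<Phi> t) (\<Phi> u))\<^sup>2" using \<rho> by (intro power_mono) auto
      also have "\<dots> \<le> 2 * (LINT t:{t<..u}|lborel. lagrangian Q \<Phi> t)"
        using admissible_displacement[OF Q_continuous Q_nonneg adm, of t u] u st by auto
      also have "\<dots> \<le> 2 * E" using E_ge[of t u] by simp
      finally have "\<rho>\<^sup>2 \<le> 8 * E" by (simp add: power_divide)
      \<comment> \<open>Since \<rho> is at most \<open>M\<close> and \<open>N' - 2\<close> is
        nonnegative, the surplus power of \<rho> is traded for a power of \<open>M\<close>.\<close>
      have "\<rho> powr N' = \<rho>\<^sup>2 * \<rho> powr (N' - 2)"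
        using pos by (simp add: powr_diff powr_numeral)
      also have "\<dots> \<le> (8 * E) * M powr (N' - 2)"
        using \<open>\<rho>\<^sup>2 \<le> 8 * E\<close> \<rho> N' E by (intro mult_mono powr_mono2) auto
      \<comment> \<open>8 is \<open>2 powr 3\<close> and 3 is at most \<open>N' + 1\<close>, which
        explains this exponent in \<sigma>1.\<close>
      also have "8 \<le> (2::real) powr (N' + 1)"
        using powr_mono[of 3 "N' + 1" "2::real"] N' by simp
      then have "(8 * E) * M powr (N' - 2) \<le> (2 powr (N' + 1) * E) * M powr (N' - 2)"
        using E by (intro mult_right_mono) auto
      also have "\<dots> = ?A * E" by simp
      also have "\<dots> \<le> max ?A ?B * E" using E by (intro mult_right_mono) auto
      finally show ?thesis .
    next
      case far: False
      have "d * (\<rho> / 2) powr N = (LINT u:{t<..t + 1}|lborel. d * (\<rho> / 2) powr N)"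
        by (simp add: set_lebesgue_integral_def)
      also have "\<dots> \<le> (LINT u:{t<..t + 1}|lborel. lagrangian Q \<Phi> u)"
      proof (rule set_integral_mono)
        show "set_integrable lborel {t<..t + 1} (\<lambda>u. d * (\<rho> / 2) powr N)"
          by (rule set_integrable_subset[of _ "{t..t + 1}"])
            (auto intro: set_integrable_compact_continuous)
        show "set_integrable lborel {t<..t + 1} (lagrangian Q \<Phi>)"
          using st by (intro lagrangian_integrable) auto
        fix u assume "u \<in> {t<..t + 1}"
        with far have "\<not> infdist (\<Phi> u) Z \<le> \<rho> / 2" by auto
        then have "\<rho> / 2 \<le> infdist (\<Phi> u) Z" by simp
        then have "d * (\<rho> / 2) powr N \<le> d * infdist (\<Phi> u) Z powr N"
          using \<rho> d N by (intro mult_left_mono powr_mono2) auto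
        also have "\<dots> \<le> Q (\<Phi> u)" using Loj[of "\<Phi> u"] Q_nonneg[of "\<Phi> u"] by simp
        also have "\<dots> \<le> lagrangian Q \<Phi> u" by (simp add: lagrangian_def)
        finally show "d * (\<rho> / 2) powr N \<le> lagrangian Q \<Phi> u" .
      qed
      also have "\<dots> \<le> E" by (rule E_ge) simp
      finally have half: "(\<rho> / 2) powr N \<le> E / d" using d by (simp add: field_simps)
      have "\<rho> powr N = 2 powr N * (\<rho> / 2) powr N" using pos by (simp add: powr_divide)
      also have "\<dots> \<le> 2 powr N' * (E / d)"
        using half N' by (intro mult_mono powr_mono) auto
      finally have N_bound: "\<rho> powr N \<le> 2 powr N' * (E / d)" .
      have "\<rho> powr N' = \<rho> powr N * \<rho> powr (N' - N)"
        using pos by (simp add: powr_add[symmetric])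
      also have "\<dots> \<le> (2 powr N' * (E / d)) * M powr (N' - N)"
        using N_bound \<rho> N' E d by (intro mult_mono powr_mono2) auto
      also have "\<dots> = ?B * E" by simp
      also have "\<dots> \<le> max ?A ?B * E" using E by (intro mult_right_mono) auto
      finally show ?thesis .
    qed
  qed
qed

lemma exists_low_potential_time:
  assumes "t > 0"
  obtains u where "0 \<le> u" "u \<le> t" "t * Q (\<Phi> u) \<le> (M + L) / 2 * infdist (\<Phi> 0) Z"
proof -
  have "continuous_on {0..} \<Phi>"
    using adm by (auto simp: admissible_def intro: torus_H1_loc_continuous_on)
  then have "continuous_on {0..t} (\<lambda>u. Q (\<Phi> u))"
    by (intro continuous_on_compose2[OF Q_continuous]) (auto elim: continuous_on_subset)
  then obtain u where u: "u \<in> {0..t}" "\<And>x. x \<in> {0..t} \<Longrightarrow> Q (\<Phi> u) \<le> Q (\<Phi> x)"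
    using assms continuous_attains_inf[of "{0..t}"] by (metis atLeastatMost_empty_iff compact_Icc
        linorder_not_less order_less_imp_le)
  have "t * Q (\<Phi> u) = (LINT x:{0<..t}|lborel. Q (\<Phi> u))"
    using assms by (simp add: set_lebesgue_integral_def)
  also have "\<dots> \<le> (LINT x:{0<..t}|lborel. lagrangian Q \<Phi> x)"
  proof (rule set_integral_mono)
    show "set_integrable lborel {0<..t} (\<lambda>x. Q (\<Phi> u))"
      by (rule set_integrable_subset[of _ "{0..t}"]) (auto intro: set_integrable_compact_continuous)
    show "set_integrable lborel {0<..t} (lagrangian Q \<Phi>)" by (intro lagrangian_integrable) auto
    fix x assume "x \<in> {0<..t}"
    then have "Q (\<Phi> u) \<le> Q (\<Phi> x)" using u(2) by simp
    also have "\<dots> \<le> lagrangian Q \<Phi> x" by (simp add: lagrangian_def)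
    finally show "Q (\<Phi> u) \<le> lagrangian Q \<Phi> x" .
  qed
  also have "\<dots> \<le> (LINT x:{0<..}|lborel. lagrangian Q \<Phi> x)"
    by (rule LINT_mono_set) (auto intro!: lagrangian_integrable lagrangian_nonneg)
  \<comment> \<open>The total action is the tail energy from time 0.\<close>
  also have "\<dots> \<le> (M + L) / 2 * infdist (\<Phi> 0) Z" by (rule tail_energy_le) simp
  finally show ?thesis using u(1) that by auto
qed

end

theorem lemma3p2:
  fixes Q :: "'n::finite torus \<Rightarrow> real"
    and Z :: "'n torus set"
    and L d N n N' \<sigma>1 \<sigma>2 :: real
    and \<Phi>0 :: "'n torus"
    and \<Phi> :: "real \<Rightarrow> 'n torus"
  assumes Q_nonneg: "\<And>x. 0 \<le> Q x"
    and Q_analytic: "torus_real_analytic Q"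
    and Z_def: "Z = {x. Q x = 0}"
    and Z_nonempty: "Z \<noteq> {}"
    and L_max: "\<exists>x. L = norm (torus_gradient Q x)" "\<And>x. norm (torus_gradient Q x) \<le> L"
    and d_pos: "d > 0"
    and N_pos: "N > 0"
    and Lojasiewicz: "\<And>x. \<bar>Q x\<bar> \<ge> d * infdist x Z powr N"
    and \<Phi>_admissible: "\<Phi> \<in> admissible Q \<Phi>0"
    and \<Phi>_minimizer: "\<And>\<Psi>. \<Psi> \<in> admissible Q \<Phi>0 \<Longrightarrow> action Q \<Phi> \<le> action Q \<Psi>"
    and n_def: "n = real CARD('n)"
    and N'_def: "N' = max 2 N"
    and \<sigma>1_def: "\<sigma>1 = (2 * pi * sqrt n + L) / 2 *
           max (2 powr (N' + 1) * (2 * pi * sqrt n) powr (N' - 2))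
               (2 powr N' * (2 * pi * sqrt n) powr (N' - N) / d)"
    and \<sigma>2_def: "\<sigma>2 = (2 * pi * sqrt n + L) * \<sigma>1 powr N / (2 * d)"
  shows "\<forall>t>0.
           infdist (\<Phi> t) Z \<le> (\<sigma>1 * infdist \<Phi>0 Z) powr (1 / N') \<and>
           infdist (\<Phi> t) Z \<le> (\<sigma>2 * (infdist \<Phi>0 Z / t)) powr (1 / (N * N'))"
proof (intro allI impI conjI)
  fix t :: real assume t: "t > 0"
  define M where "M = 2 * pi * sqrt (real CARD('n))"
  have L: "L \<ge> 0" using L_max(1) by auto
  have M: "M \<ge> 0" by (simp add: M_def)
  note Lip = torus_gradient_bound_imp_Lipschitz[OF Q_analytic L_max(2)]
  note ctx = Q_nonneg L Lip Z_def Z_nonempty \<Phi>_admissible \<Phi>_minimizer M_def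
  have \<Phi>0: "\<Phi> 0 = \<Phi>0" using \<Phi>_admissible by (simp add: admissible_def)
  have N': "N' > 0" "N' \<ge> 2" "N' \<ge> N" by (auto simp: N'_def)
  have \<sigma>1: "\<sigma>1 = (M + L) / 2 * max (2 powr (N' + 1) * M powr (N' - 2)) (2 powr N' * M powr (N' - N) / d)"
    by (simp add: \<sigma>1_def n_def M_def)
  have \<sigma>1_nonneg: "\<sigma>1 \<ge> 0" unfolding \<sigma>1 using M L by (intro mult_nonneg_nonneg) (auto intro: max.coboundedI1)
  have decay: "infdist (\<Phi> t) Z powr N' \<le> \<sigma>1 * infdist (\<Phi> s) Z" if "0 \<le> s" "s \<le> t" for s
  proof -
    let ?C = "max (2 powr (N' + 1) * M powr (N' - 2)) (2 powr N' * M powr (N' - N) / d)"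
    have "infdist (\<Phi> t) Z powr N' \<le> ?C * (LINT t:{s<..}|lborel. lagrangian Q \<Phi> t)"
      by (rule infdist_powr_le_tail_energy[OF ctx d_pos N_pos Lojasiewicz N'_def that t])
    also have "\<dots> \<le> ?C * ((M + L) / 2 * infdist (\<Phi> s) Z)"
      by (intro mult_left_mono tail_energy_le[OF ctx that(1)] max.coboundedI1 mult_nonneg_nonneg
          powr_ge_zero)
    finally show ?thesis by (simp add: \<sigma>1 mult_ac)
  qed
  show "infdist (\<Phi> t) Z \<le> (\<sigma>1 * infdist \<Phi>0 Z) powr (1 / N')"
    using decay[of 0] t N' by (intro le_powr_inverse infdist_nonneg) (auto simp: \<Phi>0)
  obtain u where u: "0 \<le> u" "u \<le> t" "t * Q (\<Phi> u) \<le> (M + L) / 2 * infdist \<Phi>0 Z"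
    using exists_low_potential_time[OF ctx t] \<Phi>0 by metis
  have "d * infdist (\<Phi> u) Z powr N \<le> Q (\<Phi> u)" using Lojasiewicz[of "\<Phi> u"] Q_nonneg[of "\<Phi> u"] by simp
  also have "\<dots> \<le> (M + L) / 2 * infdist \<Phi>0 Z / t" using u(3) t by (simp add: field_simps)
  finally have low: "infdist (\<Phi> u) Z powr N \<le> (M + L) / (2 * d) * (infdist \<Phi>0 Z / t)"
    using d_pos t by (simp add: field_simps)
  \<comment> \<open>Raising \<open>decay\<close> from \<open>u\<close> to the power \<open>N\<close>
    lets \<open>low\<close>, a bound on the N-th power of the distance at \<open>u\<close>, be
    inserted. This is where the root of order N * N' and the factor \<open>\<sigma>1 powr N\<close>
    come from.\<close>
  have "infdist (\<Phi> t) Z powr (N * N') = (infdist (\<Phi> t) Z powr N') powr N"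
    by (simp add: powr_powr mult.commute)
  also have "\<dots> \<le> (\<sigma>1 * infdist (\<Phi> u) Z) powr N"
    using decay[OF u(1,2)] N_pos by (intro powr_mono2) auto
  also have "\<dots> = \<sigma>1 powr N * infdist (\<Phi> u) Z powr N"
    using \<sigma>1_nonneg by (simp add: powr_mult infdist_nonneg)
  also have "\<dots> \<le> \<sigma>1 powr N * ((M + L) / (2 * d) * (infdist \<Phi>0 Z / t))"
    by (intro mult_left_mono low) auto
  also have "\<dots> = \<sigma>2 * (infdist \<Phi>0 Z / t)"
    by (simp add: \<sigma>2_def n_def M_def)
  finally show "infdist (\<Phi> t) Z \<le> (\<sigma>2 * (infdist \<Phi>0 Z / t)) powr (1 / (N * N'))"
    using N_pos N' by (intro le_powr_inverse infdist_nonneg) auto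
qed

end
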